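(* Let $A$, $B$, $X$, $V$, $U$ be as described in the context. Let $\mathcal{G}:[0,+\infty)\to[0,+\infty)$ be a continuous strictly increasing bijection (so $\mathcal G(0)=0$ and $\mathcal G>0$ on $(0,+\infty)$), and let $\mathcal{F}(x)=x\,(\mathcal{G}(x))^2$ for $x\ge 0$; $\mathcal G^{-1}$ and $\mathcal F^{-1}$ denote the inverse functions. For $(w_0,w_1)\in\mathcal{D}(A)\times V$, $(w_0,w_1)\neq(0,0)$, put $$\Lambda=\frac{\|(w_0,w_1)\|^2_{\mathcal{D}(A)\times V}}{\|(w_0,w_1)\|^2_{V\times X}}.$$ (1) Assume that there exists $C>0$ such that for all non-identically zero initial data $(w_0,w_1)\in\mathcal{D}(A)\times V$ and all $t>0$, the solution $w$ of the damped problem $w''+Aw+BB^*w'=0$, $w(0)=w_0$, $w'(0)=w_1$, satisfies $$E(w(t))\le C\,\|(w_0,w_1)\|^2_{\mathcal{D}(A)\times V}\;\mathcal{G}^{-1}\!\left(\frac1t\right).$$ Then there exists a (possibly different) constant $C>0$ such that for all non-identically zero initial data $(w_0,w_1)\in\mathcal{D}(A)\times V$, the solution $\phi$ of the undamped problem $\phi''+A\phi=0$, $\phi(0)=w_0$, $\phi'(0)=w_1$, satisfies $$\|(w_0,w_1)\|^2_{V\times X}\le 16\int_0^{1/\mathcal{G}\left(\frac{1}{2C\Lambda}\right)}\|B^*\phi'(t)\|_U^2\,dt.$$ (2) Assume that $x\mapsto x\,\mathcal{F}^{-1}\!\left(\frac1x\right)$ is an increasing function (on $(0,+\infty)$) and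 that there exists $C>0$ such that for all non-identically zero initial data $(w_0,w_1)\in\mathcal{D}(A)\times V$, the solution $\phi$ of the undamped problem $\phi''+A\phi=0$, $\phi(0)=w_0$, $\phi'(0)=w_1$, satisfies $$\|(w_0,w_1)\|^2_{V\times X}\le C\int_0^{1/\mathcal{G}\left(\frac{1}{2C\Lambda}\right)}\|B^*\phi'(t)\|_U^2\,dt.$$ Then there exists a (possibly different) constant $C>0$ such that for all non-identically zero initial data $(w_0,w_1)\in\mathcal{D}(A)\times V$ and all $t>0$, the solution $w$ of the damped problem $w''+Aw+BB^*w'=0$, $w(0)=w_0$, $w'(0)=w_1$, satisfies $$E(w(t))\le C\,\|(w_0,w_1)\|^2_{\mathcal{D}(A)\times V}\;\mathcal{F}^{-1}\!\left(\frac{1}{\sqrt t}\right).$$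
   Context: $X$ is a complex Hilbert space with norm $\|\cdot\|_X$, and $A$ is a linear, unbounded, self-adjoint, strictly positive operator in $X$ with domain $\mathcal{D}(A)$. $V=\mathcal{D}(A^{1/2})$ with norm $\|x\|_V=\|A^{1/2}x\|_X$. $U$ is a complex Hilbert space identified with its dual, and $B\in\mathcal{L}(U,X)$ is a bounded linear operator with adjoint $B^*\in\mathcal{L}(X,U)$. Norms on the product spaces: $\|(w_0,w_1)\|^2_{V\times X}=\|A^{1/2}w_0\|_X^2+\|w_1\|_X^2$ and $\|(w_0,w_1)\|^2_{\mathcal{D}(A)\times V}=\|Aw_0\|_X^2+\|A^{1/2}w_1\|_X^2$. Primes denote differentiation in time. The energy is $E(w(t))=\frac12\left\{\|w'(t)\|_X^2+\|A^{1/2}w(t)\|_X^2\right\}$. Both the damped and the undamped problems are well posed in $V\times X$ and in $\mathcal{D}(A)\times V$ (semigroup solutions). *)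

theory Defs
  imports "HOL-Analysis.Analysis"
begin

section \<open>Complex Hilbert spaces\<close>

text \<open>
  The underlying real Hilbert structure is the library's (so that norms, limits, derivatives and
  integrals are the library's); its inner product is the real part of the complex one.
  The complex inner product is conjugate-linear in its first argument.
\<close>

class complex_hilbert = real_inner + complete_space +
  fixes scaleC :: "complex \<Rightarrow> 'a \<Rightarrow> 'a"
    and cinner :: "'a \<Rightarrow> 'a \<Rightarrow> complex"
  assumes scaleC_add_right: "scaleC a (x + y) = scaleC a x + scaleC a y"
    and scaleC_add_left: "scaleC (a + b) x = scaleC a x + scaleC b x"
    and scaleC_scaleC: "scaleC a (scaleC b x) = scaleC (a * b) x"
    and scaleC_of_real: "scaleC (complex_of_real r) x = scaleR r x"
    and cinner_commute: "cinner x y = cnj (cinner y x)"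
    and cinner_add_left: "cinner (x + y) z = cinner x z + cinner y z"
    and cinner_scaleC_left: "cinner (scaleC a x) y = cnj a * cinner x y"
    and inner_eq_Re_cinner: "inner x y = Re (cinner x y)"

definition bounded_clinear :: "('a::complex_hilbert \<Rightarrow> 'b::complex_hilbert) \<Rightarrow> bool" where
  "bounded_clinear f \<longleftrightarrow> bounded_linear f \<and> (\<forall>c x. f (scaleC c x) = scaleC c (f x))"

definition cadjoint ::
  "('a::complex_hilbert \<Rightarrow> 'b::complex_hilbert) \<Rightarrow> 'b \<Rightarrow> 'a" where
  "cadjoint f = (THE g. \<forall>x y. cinner (f x) y = cinner x (g y))"


section \<open>Operators with a domain\<close>

text \<open>
  An operator in \<open>X\<close> is given by its domain \<open>D\<close> and a total function of which only the
  restriction to \<open>D\<close> is used.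
\<close>

definition linear_operator :: "'a::complex_hilbert set \<Rightarrow> ('a \<Rightarrow> 'a) \<Rightarrow> bool" where
  "linear_operator D A \<longleftrightarrow>
     0 \<in> D \<and>
     (\<forall>x\<in>D. \<forall>y\<in>D. x + y \<in> D \<and> A (x + y) = A x + A y) \<and>
     (\<forall>c. \<forall>x\<in>D. scaleC c x \<in> D \<and> A (scaleC c x) = scaleC c (A x))"

definition unbounded_operator :: "'a::complex_hilbert set \<Rightarrow> ('a \<Rightarrow> 'a) \<Rightarrow> bool" where
  "unbounded_operator D A \<longleftrightarrow> \<not> (\<exists>K. \<forall>x\<in>D. norm (A x) \<le> K * norm x)"

definition operator_graph :: "'a::complex_hilbert set \<Rightarrow> ('a \<Rightarrow> 'a) \<Rightarrow> ('a \<times> 'a) set" where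
  "operator_graph D A = {(x, A x) |x. x \<in> D}"

text \<open>For a densely defined operator this is the graph of its adjoint.\<close>

definition adjoint_graph :: "'a::complex_hilbert set \<Rightarrow> ('a \<Rightarrow> 'a) \<Rightarrow> ('a \<times> 'a) set" where
  "adjoint_graph D A = {(y, z). \<forall>x\<in>D. cinner (A x) y = cinner x z}"

definition self_adjoint_operator :: "'a::complex_hilbert set \<Rightarrow> ('a \<Rightarrow> 'a) \<Rightarrow> bool" where
  "self_adjoint_operator D A \<longleftrightarrow>
     linear_operator D A \<and> closure D = UNIV \<and> adjoint_graph D A = operator_graph D A"

text \<open>
  For a self-adjoint operator \<open>cinner (A x) x\<close> is real.  Strict positivity is uniform, as is
  needed for \<open>x \<mapsto> norm (A\<^sup>1\<^sup>/\<^sup>2 x)\<close> to be a Hilbert norm on the domain of \<open>A\<^sup>1\<^sup>/\<^sup>2\<close>.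
\<close>

definition positive_operator :: "'a::complex_hilbert set \<Rightarrow> ('a \<Rightarrow> 'a) \<Rightarrow> bool" where
  "positive_operator D A \<longleftrightarrow> (\<forall>x\<in>D. Re (cinner (A x) x) \<ge> 0)"

definition strictly_positive_operator :: "'a::complex_hilbert set \<Rightarrow> ('a \<Rightarrow> 'a) \<Rightarrow> bool" where
  "strictly_positive_operator D A \<longleftrightarrow>
     (\<exists>m>0. \<forall>x\<in>D. Re (cinner (A x) x) \<ge> m * (norm x)\<^sup>2)"

text \<open>
  \<open>S\<close> with domain \<open>V\<close> is the (unique) positive self-adjoint square root of \<open>A\<close>: the domain of
  the composition \<open>S \<circ> S\<close> is exactly the domain \<open>D\<close> of \<open>A\<close>.
\<close>

definition operator_sqrt ::
  "'a::complex_hilbert set \<Rightarrow> ('a \<Rightarrow> 'a) \<Rightarrow> 'a set \<Rightarrow> ('a \<Rightarrow> 'a) \<Rightarrow> bool" where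
  "operator_sqrt D A V S \<longleftrightarrow>
     self_adjoint_operator V S \<and> positive_operator V S \<and>
     D = {x \<in> V. S x \<in> V} \<and> (\<forall>x\<in>D. A x = S (S x))"


section \<open>Second-order evolution problems\<close>

text \<open>Time derivative on \<open>[0,\<infinity>)\<close>, one-sided at \<open>0\<close>.\<close>

definition tderiv :: "(real \<Rightarrow> 'a::real_normed_vector) \<Rightarrow> real \<Rightarrow> 'a" where
  "tderiv w t = vector_derivative w (at t within {0..})"

text \<open>
  The semigroup solution of \<open>w'' + A w + K w' = 0\<close>, \<open>w(0) = w0\<close>, \<open>w'(0) = w1\<close> for data in
  \<open>D(A) \<times> V\<close>, that is, the solution in
  \<open>C([0,\<infinity>); D(A)) \<inter> C\<^sup>1([0,\<infinity>); V) \<inter> C\<^sup>2([0,\<infinity>); X)\<close>, where \<open>D(A)\<close> and \<open>V\<close>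
  carry the norms \<open>norm (A x)\<close> and \<open>norm (S x)\<close>.
\<close>

definition wave_solution ::
  "'a::complex_hilbert set \<Rightarrow> ('a \<Rightarrow> 'a) \<Rightarrow> 'a set \<Rightarrow> ('a \<Rightarrow> 'a) \<Rightarrow> ('a \<Rightarrow> 'a) \<Rightarrow>
   'a \<Rightarrow> 'a \<Rightarrow> (real \<Rightarrow> 'a) \<Rightarrow> bool" where
  "wave_solution D A V S K w0 w1 w \<longleftrightarrow>
     (\<forall>t\<ge>0. w t \<in> D) \<and> continuous_on {0..} (\<lambda>t. A (w t)) \<and>
     (\<forall>t\<ge>0. tderiv w t \<in> V \<and>
        (w has_vector_derivative tderiv w t) (at t within {0..}) \<and>
        ((\<lambda>s. S (w s)) has_vector_derivative S (tderiv w t)) (at t within {0..})) \<and>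
     continuous_on {0..} (\<lambda>t. S (tderiv w t)) \<and>
     (\<forall>t\<ge>0. (tderiv w has_vector_derivative tderiv (tderiv w) t) (at t within {0..})) \<and>
     continuous_on {0..} (tderiv (tderiv w)) \<and>
     (\<forall>t\<ge>0. tderiv (tderiv w) t + A (w t) + K (tderiv w t) = 0) \<and>
     w 0 = w0 \<and> tderiv w 0 = w1"

definition damped_solution ::
  "'a::complex_hilbert set \<Rightarrow> ('a \<Rightarrow> 'a) \<Rightarrow> 'a set \<Rightarrow> ('a \<Rightarrow> 'a) \<Rightarrow>
   ('u::complex_hilbert \<Rightarrow> 'a) \<Rightarrow> 'a \<Rightarrow> 'a \<Rightarrow> (real \<Rightarrow> 'a) \<Rightarrow> bool" where
  "damped_solution D A V S B = wave_solution D A V S (\<lambda>x. B (cadjoint B x))"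

definition undamped_solution ::
  "'a::complex_hilbert set \<Rightarrow> ('a \<Rightarrow> 'a) \<Rightarrow> 'a set \<Rightarrow> ('a \<Rightarrow> 'a) \<Rightarrow>
   'a \<Rightarrow> 'a \<Rightarrow> (real \<Rightarrow> 'a) \<Rightarrow> bool" where
  "undamped_solution D A V S = wave_solution D A V S (\<lambda>x. 0)"

definition energy :: "('a::complex_hilbert \<Rightarrow> 'a) \<Rightarrow> (real \<Rightarrow> 'a) \<Rightarrow> real \<Rightarrow> real" where
  "energy S w t = 1/2 * ((norm (tderiv w t))\<^sup>2 + (norm (S (w t)))\<^sup>2)"

definition sqnorm_VX :: "('a::complex_hilbert \<Rightarrow> 'a) \<Rightarrow> 'a \<Rightarrow> 'a \<Rightarrow> real" where
  "sqnorm_VX S w0 w1 = (norm (S w0))\<^sup>2 + (norm w1)\<^sup>2"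

definition sqnorm_DV ::
  "('a::complex_hilbert \<Rightarrow> 'a) \<Rightarrow> ('a \<Rightarrow> 'a) \<Rightarrow> 'a \<Rightarrow> 'a \<Rightarrow> real" where
  "sqnorm_DV A S w0 w1 = (norm (A w0))\<^sup>2 + (norm (S w1))\<^sup>2"

definition Lambda ::
  "('a::complex_hilbert \<Rightarrow> 'a) \<Rightarrow> ('a \<Rightarrow> 'a) \<Rightarrow> 'a \<Rightarrow> 'a \<Rightarrow> real" where
  "Lambda A S w0 w1 = sqnorm_DV A S w0 w1 / sqnorm_VX S w0 w1"

end

theory Submission
  imports Defs
begin

text \<open>
  Write \<open>p = A\<^sup>1\<^sup>/\<^sup>2 w\<close>, \<open>v = w'\<close>, so that the equations become first-order systems in \<open>X \<times> X\<close> with a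
  maximal dissipative generator; solutions for data in \<open>D(A) \<times> V\<close> exist by Yosida approximation.
  Let \<open>w\<close> be damped and \<open>\<phi>\<close> undamped with the same data.  The energy of \<open>w - \<phi>\<close> has derivative
  \<open>- \<langle>B\<^sup>* w', B\<^sup>* (w' - \<phi>')\<rangle>\<close>, whence on \<open>[0, T]\<close>, in the norm of \<open>L\<^sup>2\<close>,
  \<open>\<parallel>B\<^sup>* w'\<parallel>\<^sup>2 \<le> \<parallel>B\<^sup>* \<phi>'\<parallel>\<^sup>2 \<le> (2 + 8 \<beta>\<^sup>4 T\<^sup>2) \<parallel>B\<^sup>* w'\<parallel>\<^sup>2\<close>, where \<open>\<beta>\<close> bounds \<open>B\<^sup>*\<close>, and
  \<open>\<parallel>B\<^sup>* w'\<parallel>\<^sup>2\<close> is the loss of energy.  For (1), choose \<open>T\<close> such that the decay hypothesis leaves at most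
  half of the energy.  For (2), observability from time \<open>s\<close> on, applied to the energy normalised by the
  \<open>D(A) \<times> V\<close> norm, reads \<open>F (e s) \<le> \<kappa> (e s - e (s + 1 / G (e s)))\<close>, and summing this up to time \<open>t\<close>
  bounds \<open>F (e t)\<close> by a multiple of \<open>1 / sqrt t\<close>.
\<close>

section \<open>Derivatives\<close>

text \<open>The obstacle in (2) is that the observation time depends on \<open>Lambda\<close> of the
  state at time \<open>s\<close>, hence on its \<open>D(A) \<times> V\<close> norm, which the energy
  does not control. That norm is comparable to the norm of the generator applied to the state, and
  the latter decreases along the damped flow, because time increments of a solution again solve the
  linear system. So the observation time from \<open>s\<close> on is at most
  \<open>1 / G (e s)\<close>, where \<open>e\<close> is the energy divided by one fixed multiple of
  the initial \<open>D(A) \<times> V\<close> norm. The weight in \<open>F\<close> comes from the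
  factor \<open>T\<^sup>2\<close> in the comparison of the two flows: with
  \<open>T = 1 / G (e s)\<close>, multiplication by \<open>(G (e s))\<^sup>2\<close> clears
  \<open>T\<^sup>2\<close> and leaves \<open>F (e s)\<close> on the left. All estimates use the real
  part of the inner product only; the complex structure enters where adjoints have to be
  identified.\<close>

lemma real_deriv_bound:
  fixes f :: "real \<Rightarrow> real"
  assumes "\<And>t. t \<ge> 0 \<Longrightarrow> (f has_real_derivative f' t) (at t within {0..})"
    and "\<And>t. t \<ge> 0 \<Longrightarrow> f' t \<le> c" and "0 \<le> a" "a \<le> b"
  shows "f b \<le> f a + c * (b - a)"
proof -
  have "\<exists>x\<in>{a..b}. f b - f a = (\<lambda>h. f' x * h) (b - a)"
  proof (rule mvt_very_simple[OF \<open>a \<le> b\<close>])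
    fix x assume "a \<le> x" "x \<le> b"
    then have "(f has_real_derivative f' x) (at x within {a..b})"
      using assms(1)[of x] \<open>0 \<le> a\<close> by (auto intro: has_field_derivative_subset)
    then show "(f has_derivative (\<lambda>h. f' x * h)) (at x within {a..b})"
      by (simp add: has_field_derivative_def)
  qed
  then obtain x where "x \<in> {a..b}" "f b - f a = f' x * (b - a)" by auto
  then show ?thesis
    using assms(2)[of x] \<open>0 \<le> a\<close> \<open>a \<le> b\<close> mult_right_mono[of "f' x" c "b - a"] by auto
qed

lemma has_real_derivative_norm_sq:
  fixes z :: "real \<Rightarrow> 'a::real_inner"
  assumes "(z has_vector_derivative z') (at t within T)"
  shows "((\<lambda>s. (norm (z s))\<^sup>2) has_real_derivative 2 * inner z' (z t)) (at t within T)"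
proof -
  have "((\<lambda>s. inner (z s) (z s)) has_vector_derivative inner (z t) z' + inner z' (z t)) (at t within T)"
    using assms unfolding has_vector_derivative_def
    by (auto intro!: derivative_eq_intros simp: inner_simps algebra_simps)
  then show ?thesis
    by (simp add: has_real_derivative_iff_has_vector_derivative power2_norm_eq_inner inner_commute)
qed

text \<open>The common comparison tool for dissipative flows: applied to a difference of two
  solutions it yields contraction, and when that difference vanishes at time 0 it yields
  equality.\<close>

lemma dissipative_norm_le:
  fixes z :: "real \<Rightarrow> 'a::real_inner"
  assumes "\<And>t. t \<ge> 0 \<Longrightarrow> (z has_vector_derivative z' t) (at t within {0..})"
    and "\<And>t. t \<ge> 0 \<Longrightarrow> inner (z' t) (z t) \<le> 0" and "0 \<le> a" "a \<le> b"
  shows "norm (z b) \<le> norm (z a)"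
proof -
  have "(norm (z b))\<^sup>2 \<le> (norm (z a))\<^sup>2 + 0 * (b - a)"
    by (rule real_deriv_bound[where f' = "\<lambda>t. 2 * inner (z' t) (z t)"])
      (use assms in \<open>auto intro!: has_real_derivative_norm_sq\<close>)
  then show ?thesis by (simp add: power2_le_iff_abs_le)
qed


section \<open>Closed subspaces and the Riesz representation\<close>

text \<open>A minimising sequence for the distance to \<open>M\<close> is Cauchy by the
  parallelogram law; its limit attains the distance, and perturbing the limit inside
  \<open>M\<close> gives orthogonality.\<close>

lemma closed_subspace_projection:
  fixes M :: "'a::{real_inner,banach} set"
  assumes M: "subspace M" "closed M"
  shows "\<exists>y\<in>M. \<forall>z\<in>M. inner (x - y) z = 0"
proof -
  define d where "d = infdist x M"
  have ne: "M \<noteq> {}" using subspace_0[OF M(1)] by auto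
  have d: "d \<le> norm (x - z)" if "z \<in> M" for z
    unfolding d_def using infdist_le[OF that, of x] by (simp add: dist_norm)
  have d0: "d \<ge> 0" by (simp add: d_def infdist_nonneg)
  have "\<exists>y\<in>M. norm (x - y) < d + 1 / real (Suc n)" for n
  proof -
    have "infdist x M < d + 1 / real (Suc n)" by (simp add: d_def)
    then show ?thesis
      using ne cInf_lessD[of "dist x ` M"] by (auto simp: infdist_def dist_norm)
  qed
  then obtain y where y: "\<And>n. y n \<in> M" "\<And>n. norm (x - y n) < d + 1 / real (Suc n)" by metis
  \<comment> \<open>Parallelogram identity; the midpoint of \<open>u\<close> and \<open>v\<close>
    lies in \<open>M\<close>, so its distance from \<open>x\<close> is at least
    \<open>d\<close>.\<close>
  have par: "(norm (u - v))\<^sup>2 \<le> 2 * (norm (x - u))\<^sup>2 + 2 * (norm (x - v))\<^sup>2 - 4 * d\<^sup>2"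
    if "u \<in> M" "v \<in> M" for u v
  proof -
    let ?m = "(1/2) *\<^sub>R (u + v)"
    have "?m \<in> M" using M(1) that by (simp add: subspace_add subspace_scale)
    then have "d\<^sup>2 \<le> (norm (x - ?m))\<^sup>2" using d d0 by (simp add: power_mono)
    moreover have "(norm (u - v))\<^sup>2 = 2 * (norm (x - u))\<^sup>2 + 2 * (norm (x - v))\<^sup>2 - 4 * (norm (x - ?m))\<^sup>2"
      unfolding power2_norm_eq_inner by (simp add: inner_simps inner_commute algebra_simps)
    ultimately show ?thesis by linarith
  qed
  have sq: "(norm (x - y n))\<^sup>2 \<le> d\<^sup>2 + (2 * d + 1) / real (Suc n)" for n
  proof -
    let ?e = "1 / real (Suc n)"
    have "(norm (x - y n))\<^sup>2 \<le> (d + ?e)\<^sup>2" using y(2)[of n] by (simp add: power_mono)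
    also have "\<dots> = d\<^sup>2 + 2 * d * ?e + ?e * ?e" by (simp add: power2_eq_square algebra_simps)
    also have "\<dots> \<le> d\<^sup>2 + 2 * d * ?e + ?e * 1" by (intro add_left_mono mult_left_mono) auto
    finally show ?thesis by (simp add: add_divide_distrib)
  qed
  have "Cauchy y"
  proof (rule CauchyI)
    fix e :: real assume "e > 0"
    define c where "c = 4 * (2 * d + 1)"
    have c: "c > 0" using d0 by (simp add: c_def)
    obtain N where N: "c / e\<^sup>2 < real N" using reals_Archimedean2 by blast
    have "norm (y m - y n) < e" if "m \<ge> N" "n \<ge> N" for m n
    proof -
      have b: "(2 * d + 1) / real (Suc k) < e\<^sup>2 / 4" if "k \<ge> N" for k
      proof -
        have "c / e\<^sup>2 < real (Suc k)" using N that by linarith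
        then have "c < e\<^sup>2 * real (Suc k)" using \<open>e > 0\<close> by (simp add: field_simps)
        then show ?thesis by (simp add: c_def field_simps)
      qed
      have "(norm (y m - y n))\<^sup>2 < e\<^sup>2"
        using par[OF y(1) y(1), of m n] sq[of m] sq[of n] b[OF that(1)] b[OF that(2)] by linarith
      then show ?thesis using \<open>e > 0\<close> by (simp add: power_less_imp_less_base)
    qed
    then show "\<exists>M. \<forall>m\<ge>M. \<forall>n\<ge>M. norm (y m - y n) < e" by blast
  qed
  then obtain l where l: "y \<longlonglongrightarrow> l" using Cauchy_convergent convergent_def by blast
  have lM: "l \<in> M" using closed_sequentially[OF M(2) y(1) l] .
  have "norm (x - l) \<le> d"
  proof (rule LIMSEQ_le)
    show "(\<lambda>n. norm (x - y n)) \<longlonglongrightarrow> norm (x - l)" by (intro tendsto_intros l)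
    show "(\<lambda>n. d + 1 / real (Suc n)) \<longlonglongrightarrow> d"
      using tendsto_add[OF tendsto_const LIMSEQ_inverse_real_of_nat, of d] by (simp add: inverse_eq_divide)
    show "\<exists>N. \<forall>n\<ge>N. norm (x - y n) \<le> d + 1 / real (Suc n)" using y(2) less_imp_le by blast
  qed
  have ort: "inner (x - l) z = 0" if z: "z \<in> M" for z
  proof (cases "z = 0")
    case False
    \<comment> \<open>The choice of \<open>c\<close> that minimises the distance from
      \<open>x\<close> along the line through \<open>l\<close> in direction
      \<open>z\<close>.\<close>
    define c where "c = inner (x - l) z / (norm z)\<^sup>2"
    have "l + c *\<^sub>R z \<in> M" using M(1) lM z by (simp add: subspace_add subspace_scale)
    from d[OF this] \<open>norm (x - l) \<le> d\<close> have "norm (x - l) \<le> norm (x - (l + c *\<^sub>R z))" by simp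
    then have "(norm (x - l))\<^sup>2 \<le> (norm ((x - l) - c *\<^sub>R z))\<^sup>2" by (simp add: power_mono algebra_simps)
    also have "\<dots> = (norm (x - l))\<^sup>2 - 2 * c * inner (x - l) z + c\<^sup>2 * (norm z)\<^sup>2"
      unfolding power2_norm_eq_inner by (simp add: inner_simps inner_commute power2_eq_square algebra_simps)
    also have "\<dots> = (norm (x - l))\<^sup>2 - (inner (x - l) z)\<^sup>2 / (norm z)\<^sup>2"
      using False by (simp add: c_def power2_eq_square)
    finally have "(inner (x - l) z)\<^sup>2 / (norm z)\<^sup>2 \<le> 0" by simp
    then show ?thesis using False by (simp add: divide_le_0_iff)
  qed simp
  with lM show ?thesis by blast
qed

text \<open>Serves both for the density of a domain and for surjectivity: it is enough to have a
  closed range whose orthogonal complement is trivial.\<close>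

lemma closed_subspace_eq_UNIV:
  fixes M :: "'a::{real_inner,banach} set"
  assumes "subspace M" "closed M" "\<And>x. (\<And>z. z \<in> M \<Longrightarrow> inner z x = 0) \<Longrightarrow> x = 0"
  shows "M = UNIV"
proof -
  have "x \<in> M" for x
  proof -
    obtain y where y: "y \<in> M" "\<And>z. z \<in> M \<Longrightarrow> inner (x - y) z = 0"
      using closed_subspace_projection[OF assms(1,2)] by blast
    have "x - y = 0" using y(2) by (intro assms(3)) (simp add: inner_commute)
    with y(1) show ?thesis by simp
  qed
  then show ?thesis by auto
qed

lemma riesz_representation:
  fixes f :: "'a::{real_inner,banach} \<Rightarrow> real"
  assumes f: "bounded_linear f"
  obtains y where "\<And>x. f x = inner x y"
proof (cases "\<forall>x. f x = 0")
  case True then show thesis using that[of 0] by simp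
next
  case False
  then obtain x where x: "f x \<noteq> 0" by blast
  interpret f: bounded_linear f by fact
  let ?M = "{z. f z = 0}"
  have "subspace ?M" by (auto simp: subspace_def f.zero f.add f.scaleR)
  moreover have "closed ?M"
    by (rule closed_Collect_eq[OF f.continuous_on[OF continuous_on_id] continuous_on_const])
  ultimately obtain y where y: "f y = 0" "\<And>z. f z = 0 \<Longrightarrow> inner (x - y) z = 0"
    using closed_subspace_projection[of ?M x] by auto
  \<comment> \<open>\<open>n\<close> is normal to the kernel of \<open>f\<close>, and every
    \<open>z\<close> differs from a multiple of \<open>n\<close> by an element of that
    kernel.\<close>
  define n where "n = x - y"
  have fn: "f n = f x" using y by (simp add: n_def f.diff)
  then have "n \<noteq> 0" using x by (auto simp: f.zero)
  have "f z = inner z ((f n / (norm n)\<^sup>2) *\<^sub>R n)" for z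
  proof -
    have "f (z - (f z / f n) *\<^sub>R n) = 0" using fn x by (simp add: f.diff f.scaleR)
    then have "inner n (z - (f z / f n) *\<^sub>R n) = 0" using y(2) by (simp add: n_def)
    then have "inner n z = f z / f n * (norm n)\<^sup>2"
      by (simp add: inner_simps power2_norm_eq_inner)
    then show ?thesis using \<open>n \<noteq> 0\<close> fn x by (simp add: inner_commute field_simps)
  qed
  then show thesis by (rule that)
qed


section \<open>Contraction semigroups\<close>

lemma bounded_linear_flow:
  fixes L :: "'a::banach \<Rightarrow> 'a"
  assumes L: "bounded_linear L"
  shows "\<exists>u. u 0 = x \<and> (\<forall>t. (u has_vector_derivative L (u t)) (at t))"
proof -
  interpret L: bounded_linear L by fact
  obtain K where K: "\<And>x. norm (L x) \<le> norm x * K" "K > 0" using L.pos_bounded by blast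
  \<comment> \<open>The terms of the exponential series. In \<open>f'\<close> the case
    \<open>n = 0\<close> is set apart because truncated subtraction would turn the derivative of the
    constant term into \<open>x\<close> instead of 0.\<close>
  define f where "f n t = (t ^ n / fact n) *\<^sub>R (L ^^ n) x" for n :: nat and t :: real
  define f' where "f' n t = (if n = 0 then 0 else (t ^ (n - 1) / fact (n - 1)) *\<^sub>R (L ^^ n) x)"
    for n :: nat and t :: real
  have pow: "norm ((L ^^ n) x) \<le> K ^ n * norm x" for n
  proof (induction n)
    case (Suc n)
    have "norm ((L ^^ Suc n) x) \<le> norm ((L ^^ n) x) * K" using K(1) by simp
    also have "\<dots> \<le> (K ^ n * norm x) * K" using Suc K(2) by (intro mult_right_mono) auto
    finally show ?case by (simp add: algebra_simps)
  qed simp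
  have dl: "f' (Suc n) t = L (f n t)" for n t
    by (simp add: f_def f'_def L.scaleR)
  have fd: "(f n has_derivative (\<lambda>h. h *\<^sub>R f' n t)) (at t within T)" for n t T
  proof -
    have "((\<lambda>t. t ^ n / fact n) has_real_derivative (if n = 0 then 0 else t ^ (n - 1) / fact (n - 1)))
        (at t within T)"
    proof (cases n)
      case (Suc m)
      have "((\<lambda>t. t ^ Suc m / fact (Suc m)) has_real_derivative real (Suc m) * t ^ m / fact (Suc m)) (at t within T)"
        using DERIV_cdivide[OF DERIV_pow[of "Suc m" t T], of "fact (Suc m)"] by simp
      moreover have "real (Suc m) * t ^ m / fact (Suc m) = t ^ m / fact m"
        by (simp add: fact_Suc del: of_nat_Suc)
      ultimately show ?thesis using Suc by simp
    qed simp
    then have "(f n has_vector_derivative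
        (if n = 0 then 0 else t ^ (n - 1) / fact (n - 1)) *\<^sub>R (L ^^ n) x) (at t within T)"
      unfolding f_def has_real_derivative_iff_has_vector_derivative
      by (intro bounded_linear.has_vector_derivative[OF bounded_linear_scaleR_left])
    then show ?thesis by (simp add: has_vector_derivative_def f'_def if_distrib[of "\<lambda>c. c *\<^sub>R _"] cong: if_cong)
  qed
  have ul: "uniform_limit {-R..R} (\<lambda>n t. \<Sum>i<n. f i t) (\<lambda>t. \<Sum>i. f i t) sequentially"
    and sm: "t \<in> {-R..R} \<Longrightarrow> summable (\<lambda>i. f i t)" for R t
  proof -
    have bd: "norm (f n t) \<le> (R * K) ^ n /\<^sub>R fact n * norm x" if "t \<in> {-R..R}" for n t
    proof -
      have "\<bar>t\<bar> \<le> R" using that by auto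
      then have "\<bar>t\<bar> ^ n \<le> R ^ n" by (simp add: power_mono)
      then have "norm (f n t) \<le> R ^ n / fact n * (K ^ n * norm x)"
        unfolding f_def using pow[of n] \<open>\<bar>t\<bar> \<le> R\<close>
        by (auto simp: power_abs intro!: mult_mono divide_right_mono)
      then show ?thesis by (simp add: power_mult_distrib field_simps)
    qed
    have su: "summable (\<lambda>n. (R * K) ^ n /\<^sub>R fact n * norm x)"
      by (intro summable_mult2 summable_exp_generic)
    show "uniform_limit {-R..R} (\<lambda>n t. \<Sum>i<n. f i t) (\<lambda>t. \<Sum>i. f i t) sequentially"
      by (rule Weierstrass_m_test[OF bd su])
    show "t \<in> {-R..R} \<Longrightarrow> summable (\<lambda>i. f i t)"
      by (rule summable_comparison_test'[OF su bd])
  qed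
  define u where "u t = (\<Sum>i. f i t)" for t
  have s0: "(\<lambda>n. f n 0) sums x"
    using sums_finite[of "{0}" "\<lambda>n. f n 0"] by (auto simp: f_def)
  then have u0: "u 0 = x" by (simp add: u_def sums_iff)
  have "(u has_vector_derivative L (u t)) (at t)" for t
  proof -
    \<comment> \<open>Termwise differentiation is done on a compact interval; the margin 1 puts
      \<open>t\<close> in its interior, where the derivative within the interval is the full
      one.\<close>
    define R where "R = \<bar>t\<bar> + 1"
    have "\<exists>g. \<forall>s\<in>{-R..R}. (\<lambda>n. f n s) sums g s \<and> (g has_derivative (\<lambda>h. h *\<^sub>R L (u s))) (at s within {-R..R})"
    proof (rule has_derivative_series[where f' = "\<lambda>n t h. h *\<^sub>R f' n t" and x = 0])
      fix e :: real assume e: "e > 0"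
      have "\<forall>\<^sub>F n in sequentially. \<forall>s\<in>{-R..R}. dist (\<Sum>i<n. f i s) (\<Sum>i. f i s) < e / K"
        using ul[of R] e K(2) by (auto simp: uniform_limit_iff)
      then obtain N where N: "\<And>n s. n \<ge> N \<Longrightarrow> s \<in> {-R..R} \<Longrightarrow> dist (\<Sum>i<n. f i s) (u s) < e / K"
        unfolding eventually_sequentially u_def by blast
      \<comment> \<open>The derivative of term \<open>i + 1\<close> is \<open>L\<close> of term
        \<open>i\<close>, so the differentiated partial sum of length \<open>Suc m\<close> is
        \<open>L\<close> of the partial sum of length \<open>m\<close>; hence the shift from
        \<open>N\<close> to \<open>Suc N\<close>.\<close>
      have "norm ((\<Sum>i<n. h *\<^sub>R f' i s) - h *\<^sub>R L (u s)) \<le> e * norm h"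
        if nN: "n \<ge> Suc N" and sR: "s \<in> {-R..R}" for n s h
      proof -
        obtain m where m: "n = Suc m" "m \<ge> N" using nN by (cases n) auto
        have "(\<Sum>i<n. f' i s) = L (\<Sum>i<m. f i s)"
          unfolding m(1) sum.lessThan_Suc_shift using dl by (simp add: L.sum f'_def del: sum.lessThan_Suc)
        then have "(\<Sum>i<n. h *\<^sub>R f' i s) - h *\<^sub>R L (u s) = h *\<^sub>R L ((\<Sum>i<m. f i s) - u s)"
          by (simp add: scaleR_right.sum[symmetric] L.diff scaleR_diff_right scaleR_sum_right[symmetric])
        also have "norm \<dots> \<le> \<bar>h\<bar> * (norm ((\<Sum>i<m. f i s) - u s) * K)"
          using K(1) by (simp add: mult_left_mono)
        also have "\<dots> \<le> \<bar>h\<bar> * (e / K * K)"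
          using N[OF m(2) sR] K(2) by (intro mult_left_mono mult_right_mono) (auto simp: dist_norm)
        finally show ?thesis using K(2) by (simp add: mult.commute)
      qed
      then show "\<forall>\<^sub>F n in sequentially. \<forall>s\<in>{-R..R}. \<forall>h. norm ((\<Sum>i<n. h *\<^sub>R f' i s) - h *\<^sub>R L (u s)) \<le> e * norm h"
        unfolding eventually_sequentially by blast
    qed (use fd s0 in \<open>auto simp: R_def\<close>)
    then obtain g where g: "\<And>s. s \<in> {-R..R} \<Longrightarrow> (\<lambda>n. f n s) sums g s"
        "\<And>s. s \<in> {-R..R} \<Longrightarrow> (g has_derivative (\<lambda>h. h *\<^sub>R L (u s))) (at s within {-R..R})" by blast
    have tR: "t \<in> {-R<..<R}" by (auto simp: R_def)
    then have "(g has_derivative (\<lambda>h. h *\<^sub>R L (u t))) (at t within {-R<..<R})"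
      by (intro has_derivative_subset[OF g(2)[of t], of "{-R<..<R}"]) auto
    then have "(g has_derivative (\<lambda>h. h *\<^sub>R L (u t))) (at t)"
      using at_within_open[OF tR] by simp
    moreover have "g s = u s" if "s \<in> {-R<..<R}" for s
      using g(1)[of s] that by (auto simp: u_def sums_iff)
    ultimately have "(u has_derivative (\<lambda>h. h *\<^sub>R L (u t))) (at t)"
      using has_derivative_transform_within_open[of g _ t UNIV "{-R<..<R}" u] tR by simp
    then show ?thesis by (simp add: has_vector_derivative_def)
  qed
  with u0 show ?thesis by blast
qed

text \<open>Testing \<open>x - l *\<^sub>R y\<close> with \<open>x\<close>. This makes resolvents
  contractions and is what closes the range in the existence proof for resolvents.\<close>

lemma norm_le_dissipative_resolvent:
  fixes x y :: "'a::real_inner"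
  assumes "inner y x \<le> 0" "l > 0"
  shows "norm x \<le> norm (x - l *\<^sub>R y)"
proof (cases "x = 0")
  case False
  have "l * inner y x \<le> 0"
    using assms by (simp add: mult_nonneg_nonpos)
  then have "norm x * norm x \<le> inner (x - l *\<^sub>R y) x"
    by (simp add: inner_diff_left power2_norm_eq_inner[symmetric] power2_eq_square)
  also have "\<dots> \<le> norm (x - l *\<^sub>R y) * norm x" by (rule norm_cauchy_schwarz)
  finally show ?thesis using False by simp
qed simp

section \<open>Maximal dissipative operators and their resolvents\<close>

locale maximal_dissipative =
  fixes D :: "'h::{real_inner,banach} set" and M :: "'h \<Rightarrow> 'h"
  assumes subspace: "subspace D"
    and add: "\<And>x y. x \<in> D \<Longrightarrow> y \<in> D \<Longrightarrow> M (x + y) = M x + M y"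
    and scale: "\<And>c x. x \<in> D \<Longrightarrow> M (c *\<^sub>R x) = c *\<^sub>R M x"
    and dissipative: "\<And>x. x \<in> D \<Longrightarrow> inner (M x) x \<le> 0"
    and range: "\<And>l y. l > 0 \<Longrightarrow> \<exists>x\<in>D. x - l *\<^sub>R M x = y"
begin

lemma diff: "x \<in> D \<Longrightarrow> y \<in> D \<Longrightarrow> M (x - y) = M x - M y"
  using add[of x "(-1) *\<^sub>R y"] scale[of y "-1"] subspace_scale[OF subspace, of y "-1"] by simp

lemma norm_le_resolvent: "x \<in> D \<Longrightarrow> l > 0 \<Longrightarrow> norm x \<le> norm (x - l *\<^sub>R M x)"
  by (intro norm_le_dissipative_resolvent dissipative)

text \<open>The resolvent, that is the inverse of \<open>1 - l M\<close>; for \<open>l > 0\<close>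
  the choice has a single candidate by \<open>J_unique\<close>.\<close>

definition J :: "real \<Rightarrow> 'h \<Rightarrow> 'h" where
  "J l y = (SOME x. x \<in> D \<and> x - l *\<^sub>R M x = y)"

lemma J:
  assumes "l > 0"
  shows "J l y \<in> D" "J l y - l *\<^sub>R M (J l y) = y"
proof -
  have "\<exists>x. x \<in> D \<and> x - l *\<^sub>R M x = y" using range[OF assms, of y] by blast
  from someI_ex[OF this] show "J l y \<in> D" "J l y - l *\<^sub>R M (J l y) = y" by (auto simp: J_def)
qed

lemma J_unique:
  assumes "l > 0" "x \<in> D" "x - l *\<^sub>R M x = y"
  shows "J l y = x"
proof -
  have "J l y - x \<in> D" using J(1)[OF assms(1)] assms(2) subspace by (simp add: subspace_diff)
  moreover have "(J l y - x) - l *\<^sub>R M (J l y - x) = (J l y - l *\<^sub>R M (J l y)) - (x - l *\<^sub>R M x)"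
    using J(1)[OF assms(1)] assms(2) by (simp add: diff scaleR_diff_right)
  ultimately show ?thesis
    using norm_le_resolvent[of "J l y - x" l] J(2)[OF assms(1), of y] assms by simp
qed

lemma norm_J: "l > 0 \<Longrightarrow> norm (J l y) \<le> norm y"
  using norm_le_resolvent[of "J l y" l] J by simp

lemma bounded_linear_J:
  assumes l: "l > 0"
  shows "bounded_linear (J l)"
proof (rule bounded_linear_intro[where K = 1])
  fix x y
  show "J l (x + y) = J l x + J l y"
  proof (rule J_unique[OF l])
    show "J l x + J l y \<in> D" using J(1)[OF l] subspace by (simp add: subspace_add)
    have "J l x + J l y - l *\<^sub>R M (J l x + J l y)
        = (J l x - l *\<^sub>R M (J l x)) + (J l y - l *\<^sub>R M (J l y))"
      using J(1)[OF l] by (simp add: add scaleR_add_right)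
    then show "J l x + J l y - l *\<^sub>R M (J l x + J l y) = x + y" using J(2)[OF l] by simp
  qed
next
  fix c x
  show "J l (c *\<^sub>R x) = c *\<^sub>R J l x"
  proof (rule J_unique[OF l])
    show "c *\<^sub>R J l x \<in> D" using J(1)[OF l] subspace by (simp add: subspace_scale)
    have "c *\<^sub>R J l x - l *\<^sub>R M (c *\<^sub>R J l x) = c *\<^sub>R (J l x - l *\<^sub>R M (J l x))"
      using J(1)[OF l] by (simp add: scale scaleR_diff_right)
    then show "c *\<^sub>R J l x - l *\<^sub>R M (c *\<^sub>R J l x) = c *\<^sub>R x" using J(2)[OF l] by simp
  qed
qed (use norm_J[OF l] in simp)

text \<open>\<open>x n\<close> is \<open>J 1\<close> of \<open>x n - M (x n)\<close>; the argument
  converges and \<open>J 1\<close> is bounded, so the limit is a value of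
  \<open>J 1\<close>.\<close>

lemma closed_graph:
  assumes "\<And>n. x n \<in> D" "x \<longlonglongrightarrow> a" "(\<lambda>n. M (x n)) \<longlonglongrightarrow> b"
  shows "a \<in> D" "M a = b"
proof -
  have "(\<lambda>n. J 1 (x n - 1 *\<^sub>R M (x n))) \<longlonglongrightarrow> J 1 (a - 1 *\<^sub>R b)"
    by (intro bounded_linear.tendsto[OF bounded_linear_J] tendsto_intros assms) simp
  moreover have "(\<lambda>n. J 1 (x n - 1 *\<^sub>R M (x n))) = x"
    using J_unique[of 1] assms(1) by (intro ext) auto
  ultimately have "a = J 1 (a - b)" using assms(2) LIMSEQ_unique by fastforce
  then show "a \<in> D" "M a = b" using J[of 1 "a - b"] by auto
qed

text \<open>If \<open>y\<close> is orthogonal to \<open>D\<close>, solve \<open>x - M x = y\<close>: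
  then \<open>0 = inner x y = inner x x - inner (M x) x\<close>, and dissipativity forces
  \<open>x = 0\<close>, so \<open>y = 0\<close>.\<close>

lemma dense: "closure D = UNIV"
proof (rule closed_subspace_eq_UNIV)
  show "subspace (closure D)"
    unfolding subspace_def
  proof (intro conjI ballI allI)
    show "0 \<in> closure D" using subspace_0[OF subspace] closure_subset by blast
    fix x y assume xy: "x \<in> closure D" "y \<in> closure D"
    then obtain f g where "\<And>n. f n \<in> D" "f \<longlonglongrightarrow> x" "\<And>n. g n \<in> D" "g \<longlonglongrightarrow> y"
      unfolding closure_sequential by blast
    then have "\<forall>n. f n + g n \<in> D" "(\<lambda>n. f n + g n) \<longlonglongrightarrow> x + y"
      using subspace by (auto simp: subspace_add intro: tendsto_add)
    then show "x + y \<in> closure D"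
      unfolding closure_sequential by (intro exI[of _ "\<lambda>n. f n + g n"] conjI)
  next
    fix c x assume "x \<in> closure D"
    then obtain f where "\<And>n. f n \<in> D" "f \<longlonglongrightarrow> x" unfolding closure_sequential by blast
    then have "\<forall>n. c *\<^sub>R f n \<in> D" "(\<lambda>n. c *\<^sub>R f n) \<longlonglongrightarrow> c *\<^sub>R x"
      using subspace by (auto simp: subspace_scale intro: tendsto_intros)
    then show "c *\<^sub>R x \<in> closure D"
      unfolding closure_sequential by (intro exI[of _ "\<lambda>n. c *\<^sub>R f n"] conjI)
  qed
  fix y assume y: "\<And>z. z \<in> closure D \<Longrightarrow> inner z y = 0"
  obtain x where x: "x \<in> D" "x - 1 *\<^sub>R M x = y" using range[of 1 y] by auto
  have "inner x y = 0" using y[of x] x(1) closure_subset by blast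
  then have "inner x x = inner (M x) x" using x(2)
    by (metis eq_iff_diff_eq_0 inner_commute inner_diff_right scaleR_one)
  then have "inner x x \<le> 0" using dissipative[OF x(1)] by simp
  then have "x = 0" by (metis inner_eq_zero_iff inner_ge_zero order_antisym)
  then show "y = 0" using x scale[OF x(1), of 0] by simp
qed simp

section \<open>The Yosida approximations and their flows\<close>

definition Y :: "real \<Rightarrow> 'h \<Rightarrow> 'h" where
  "Y l x = M (J l x)"

text \<open>So \<open>Y l\<close> is \<open>(J l - 1) / l\<close>, a bounded operator.\<close>

lemma scaleR_Y: "l > 0 \<Longrightarrow> l *\<^sub>R Y l x = J l x - x"
  using J(2)[of l x] by (simp add: Y_def algebra_simps)

lemma Y_eq: "l > 0 \<Longrightarrow> Y l x = (1 / l) *\<^sub>R (J l x - x)"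
  using scaleR_Y[of l x] by (simp flip: scaleR_Y)

lemma bounded_linear_Y:
  assumes l: "l > 0"
  shows "bounded_linear (Y l)"
proof -
  have "Y l = (\<lambda>x. (1 / l) *\<^sub>R (J l x - x))" using Y_eq[OF l] by auto
  then show ?thesis
    using l by (auto intro!: bounded_linear_const_scaleR bounded_linear_sub bounded_linear_J bounded_linear_ident)
qed

lemma Y_dissipative:
  assumes l: "l > 0"
  shows "inner (Y l x) x \<le> 0"
proof -
  have "x = J l x - l *\<^sub>R Y l x" using scaleR_Y[OF l] by simp
  then have "inner (Y l x) x = inner (Y l x) (J l x) - l * inner (Y l x) (Y l x)"
    by (metis inner_diff_right inner_scaleR_right)
  moreover have "inner (Y l x) (J l x) \<le> 0" using dissipative J(1)[OF l] by (simp add: Y_def)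
  moreover have "l * inner (Y l x) (Y l x) \<ge> 0" using l by simp
  ultimately show ?thesis by linarith
qed

lemma Y_on_D:
  assumes l: "l > 0" and x: "x \<in> D"
  shows "Y l x = J l (M x)"
proof -
  interpret J: bounded_linear "J l" by (rule bounded_linear_J[OF l])
  have "J l x - l *\<^sub>R J l (M x) = x" using J_unique[OF l x refl] by (simp add: J.diff J.scaleR)
  then have "l *\<^sub>R Y l x = l *\<^sub>R J l (M x)" using scaleR_Y[OF l, of x] by (simp add: algebra_simps)
  then show ?thesis using l by simp
qed

text \<open>The exponential flow of the bounded operator \<open>Y l\<close> started at
  \<open>x\<close>; the letter does not stand for the energy.\<close>

definition E :: "real \<Rightarrow> 'h \<Rightarrow> real \<Rightarrow> 'h" where
  "E l x = (SOME u. u 0 = x \<and> (\<forall>t. (u has_vector_derivative Y l (u t)) (at t)))"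

lemma E:
  assumes "l > 0"
  shows "E l x 0 = x" "(E l x has_vector_derivative Y l (E l x t)) (at t within T)"
proof -
  from someI_ex[OF bounded_linear_flow[OF bounded_linear_Y[OF assms]], of x]
  have "E l x 0 = x \<and> (\<forall>t. (E l x has_vector_derivative Y l (E l x t)) (at t))"
    by (simp add: E_def)
  then show "E l x 0 = x" "(E l x has_vector_derivative Y l (E l x t)) (at t within T)"
    by (auto intro: has_vector_derivative_at_within)
qed

lemma E_contraction:
  assumes l: "l > 0" and t: "t \<ge> 0"
  shows "norm (E l x t - E l y t) \<le> norm (x - y)"
proof -
  interpret Y: bounded_linear "Y l" by (rule bounded_linear_Y[OF l])
  let ?z = "\<lambda>t. E l x t - E l y t"
  have "norm (?z t) \<le> norm (?z 0)"
  proof (rule dissipative_norm_le[where z' = "\<lambda>t. Y l (?z t)"])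
    fix s :: real
    show "(?z has_vector_derivative Y l (?z s)) (at s within {0..})"
      unfolding Y.diff by (intro has_vector_derivative_diff E l)
  qed (use t l Y_dissipative in auto)
  then show ?thesis using E(1)[OF l] by simp
qed

lemma norm_E: "l > 0 \<Longrightarrow> t \<ge> 0 \<Longrightarrow> norm (E l x t) \<le> norm x"
  using dissipative_norm_le[of "E l x" "\<lambda>t. Y l (E l x t)" 0 t] E Y_dissipative by simp

text \<open>Both sides solve the same linear equation with the same initial value.\<close>

lemma Y_E:
  assumes l: "l > 0" and t: "t \<ge> 0"
  shows "Y l (E l x t) = E l (Y l x) t"
proof -
  interpret Y: bounded_linear "Y l" by (rule bounded_linear_Y[OF l])
  let ?z = "\<lambda>t. Y l (E l x t) - E l (Y l x) t"
  have "norm (?z t) \<le> norm (?z 0)"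
  proof (rule dissipative_norm_le[where z' = "\<lambda>t. Y l (?z t)"])
    fix s :: real
    show "(?z has_vector_derivative Y l (?z s)) (at s within {0..})"
      unfolding Y.diff by (intro has_vector_derivative_diff Y.has_vector_derivative E l)
  qed (use t l Y_dissipative in auto)
  then show ?thesis using E(1)[OF l] by simp
qed

lemma norm_Y_E:
  assumes "l > 0" "t \<ge> 0" "x \<in> D"
  shows "norm (Y l (E l x t)) \<le> norm (M x)"
  using norm_E[OF assms(1,2), of "Y l x"] norm_J[OF assms(1), of "M x"]
  by (simp add: Y_E Y_on_D assms)

text \<open>The leading term of the derivative is nonpositive by dissipativity of \<open>M\<close>
  at the difference of the two resolvents. Replacing the states by their resolvents costs at most
  \<open>(l + k) * norm (M x)\<close>, by the uniform bound \<open>norm_Y_E\<close>.\<close>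

lemma E_diff_le:
  assumes l: "l > 0" and k: "k > 0" and x: "x \<in> D" and t: "t \<ge> 0"
  shows "(norm (E l x t - E k x t))\<^sup>2 \<le> 4 * (l + k) * (norm (M x))\<^sup>2 * t"
proof -
  let ?m = "norm (M x)"
  have "(norm (E l x t - E k x t))\<^sup>2
      \<le> (norm (E l x 0 - E k x 0))\<^sup>2 + 4 * (l + k) * ?m\<^sup>2 * (t - 0)"
  proof (rule real_deriv_bound)
    fix s :: real assume s: "s \<ge> 0"
    show "((\<lambda>s. (norm (E l x s - E k x s))\<^sup>2) has_real_derivative
        2 * inner (Y l (E l x s) - Y k (E k x s)) (E l x s - E k x s)) (at s within {0..})"
      by (intro has_real_derivative_norm_sq has_vector_derivative_diff E l k)
    define u v a b where "u = E l x s" and "v = E k x s" and "a = J l u" and "b = J k v"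
    have ab: "a \<in> D" "b \<in> D" using J(1) l k by (auto simp: a_def b_def)
    have bd: "norm (Y l u) \<le> ?m" "norm (Y k v) \<le> ?m"
      using norm_Y_E s x l k by (auto simp: u_def v_def)
    have "u - v = (a - b) + (k *\<^sub>R Y k v - l *\<^sub>R Y l u)"
      using scaleR_Y l k by (simp add: a_def b_def)
    moreover have "M (a - b) = Y l u - Y k v" using diff[OF ab] by (simp add: Y_def a_def b_def)
    ultimately have "inner (Y l u - Y k v) (u - v)
        = inner (M (a - b)) (a - b) + inner (Y l u - Y k v) (k *\<^sub>R Y k v - l *\<^sub>R Y l u)"
      by (simp add: inner_add_right)
    also have "\<dots> \<le> 0 + norm (Y l u - Y k v) * norm (k *\<^sub>R Y k v - l *\<^sub>R Y l u)"
      using ab subspace by (intro add_mono dissipative norm_cauchy_schwarz) (simp add: subspace_diff)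
    also have "\<dots> \<le> 0 + (?m + ?m) * (k * ?m + l * ?m)"
    proof (intro add_left_mono mult_mono)
      show "norm (Y l u - Y k v) \<le> ?m + ?m"
        using norm_triangle_ineq4[of "Y l u" "Y k v"] bd by linarith
      show "norm (k *\<^sub>R Y k v - l *\<^sub>R Y l u) \<le> k * ?m + l * ?m"
        using norm_triangle_ineq4[of "k *\<^sub>R Y k v" "l *\<^sub>R Y l u"]
          mult_left_mono[OF bd(1), of l] mult_left_mono[OF bd(2), of k] l k
        unfolding norm_scaleR by linarith
    qed auto
    finally show "2 * inner (Y l (E l x s) - Y k (E k x s)) (E l x s - E k x s) \<le> 4 * (l + k) * ?m\<^sup>2"
      by (simp add: u_def v_def power2_eq_square algebra_simps)
  qed (use t in auto)
  then show ?thesis using E(1) l k by simp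
qed

section \<open>The semigroup as the limit of the approximate flows\<close>

definition lam :: "nat \<Rightarrow> real" where
  "lam n = 1 / real (Suc n)"

lemma lam: "lam n > 0" "lam \<longlonglongrightarrow> 0"
proof -
  have "lam = (\<lambda>n. inverse (real (Suc n)))" by (auto simp: lam_def inverse_eq_divide)
  then show "lam \<longlonglongrightarrow> 0" using LIMSEQ_inverse_real_of_nat by simp
qed (simp add: lam_def)

definition U :: "'h \<Rightarrow> real \<Rightarrow> 'h" where
  "U x t = lim (\<lambda>n. E (lam n) x t)"

text \<open>On \<open>D\<close> the sequence is uniformly Cauchy by \<open>E_diff_le\<close>; a
  general \<open>x\<close> is approximated from \<open>D\<close>, and contractivity makes the error
  uniform in \<open>n\<close> and \<open>t\<close>.\<close>

lemma U_uniform: "uniform_limit {0..R} (\<lambda>n. E (lam n) x) (U x) sequentially"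
proof -
  have "uniformly_Cauchy_on {0..R} (\<lambda>n. E (lam n) x)"
  proof (rule uniformly_Cauchy_onI)
    fix e :: real assume e: "e > 0"
    have "x \<in> closure D" using dense by simp
    then obtain y where y: "y \<in> D" "dist y x < e / 3"
      using e unfolding closure_approachable by (meson divide_pos_pos zero_less_numeral)
    \<comment> \<open>\<open>E_diff_le\<close> with both parameters at most \<open>lam N\<close>
      gives \<open>c / real (Suc N)\<close>, hence the factor 8; the absolute value avoids a case
      distinction on the sign of \<open>R\<close>.\<close>
    define c where "c = 8 * (norm (M y))\<^sup>2 * \<bar>R\<bar>"
    obtain N where N: "c / (e / 3)\<^sup>2 < real N" using reals_Archimedean2 by blast
    have "dist (E (lam m) x t) (E (lam n) x t) < e"
      if t: "t \<in> {0..R}" and mn: "m \<ge> N" "n \<ge> N" for t m n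
    proof -
      have t': "0 \<le> t" "t \<le> \<bar>R\<bar>" using t by auto
      have N0: "lam k \<le> lam N" if "k \<ge> N" for k using that by (simp add: lam_def frac_le)
      have "(norm (E (lam m) y t - E (lam n) y t))\<^sup>2 \<le> 4 * (lam m + lam n) * (norm (M y))\<^sup>2 * t"
        using t' y lam by (intro E_diff_le) auto
      also have "\<dots> \<le> 4 * (lam N + lam N) * (norm (M y))\<^sup>2 * \<bar>R\<bar>"
        using t' N0 mn lam(1)[of N] lam(1)[of m] lam(1)[of n] by (intro mult_mono add_mono) (auto intro: less_imp_le)
      also have "\<dots> = c / real (Suc N)" by (simp add: c_def lam_def)
      also have "\<dots> < (e / 3)\<^sup>2"
      proof -
        have "c / (e / 3)\<^sup>2 < real (Suc N)" using N by linarith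
        then show ?thesis using e by (simp add: field_simps)
      qed
      finally have 1: "norm (E (lam m) y t - E (lam n) y t) < e / 3"
        using e by (intro power_less_imp_less_base[of _ 2 "e / 3"]) auto
      have 2: "norm (E (lam k) x t - E (lam k) y t) < e / 3" for k
        using E_contraction[OF lam(1) t'(1), of k x y] y(2) by (simp add: dist_norm norm_minus_commute)
      show ?thesis
        using dist_triangle_third[of "E (lam m) x t" "E (lam m) y t" e "E (lam n) y t" "E (lam n) x t"]
          1 2[of m] 2[of n] by (simp add: dist_norm norm_minus_commute)
    qed
    then show "\<exists>N. \<forall>t\<in>{0..R}. \<forall>m\<ge>N. \<forall>n\<ge>N. dist (E (lam m) x t) (E (lam n) x t) < e" by blast
  qed
  then show ?thesis
    unfolding U_def using Cauchy_uniformly_convergent uniformly_convergent_uniform_limit_iff by blast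
qed

lemma U_continuous: "continuous_on {0..} (U x)"
proof -
  have "continuous_on {0..R} (U x)" for R
  proof (rule uniform_limit_theorem[OF _ U_uniform])
    show "\<forall>\<^sub>F n in sequentially. continuous_on {0..R} (E (lam n) x)"
      by (intro always_eventually allI continuous_on_vector_derivative[OF E(2)[OF lam(1)]])
  qed simp
  then have c: "continuous (at t within {0..t + 1}) (U x)" if "t \<ge> 0" for t
    using that by (simp add: continuous_on_eq_continuous_within)
  have "continuous (at t within {0..}) (U x)" if "t \<ge> 0" for t
  proof -
    \<comment> \<open>Near \<open>t\<close> the half-line and \<open>{0..t+1}\<close> coincide, so
      continuity on compact intervals passes to the half-line.\<close>
    have "at t within {0..} = at t within {0..t+1}"
      by (rule at_within_nhd[of t "{t-1<..<t+1}"]) auto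
    then show ?thesis using c[OF that] by simp
  qed
  then show ?thesis by (simp add: continuous_on_eq_continuous_within)
qed

lemma J_lim: "(\<lambda>n. J (lam n) x) \<longlonglongrightarrow> x"
proof -
  have *: "(\<lambda>n. J (lam n) y) \<longlonglongrightarrow> y" if y: "y \<in> D" for y
  proof -
    have "norm (J (lam n) y - y) \<le> lam n * norm (M y)" for n
    proof -
      have "J (lam n) y - y = lam n *\<^sub>R J (lam n) (M y)"
        using Y_on_D[OF lam(1) y] scaleR_Y[OF lam(1), of n y] by simp
      then show ?thesis using norm_J[OF lam(1), of n "M y"] lam(1)[of n] by simp
    qed
    then have "\<forall>\<^sub>F n in sequentially. norm (J (lam n) y - y) \<le> lam n * norm (M y)"
      by (intro always_eventually allI)
    from Lim_null_comparison[OF this tendsto_mult_left_zero[OF lam(2)]]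
    have "(\<lambda>n. J (lam n) y - y) \<longlonglongrightarrow> 0" .
    then show ?thesis by (rule LIM_zero_cancel)
  qed
  show ?thesis
  proof (rule LIMSEQ_I)
    fix e :: real assume e: "e > 0"
    have "x \<in> closure D" using dense by simp
    then obtain y where y: "y \<in> D" "dist y x < e / 3"
      using e unfolding closure_approachable by (meson divide_pos_pos zero_less_numeral)
    obtain N where N: "\<And>n. n \<ge> N \<Longrightarrow> norm (J (lam n) y - y) < e / 3"
      using LIMSEQ_D[OF *[OF y(1)], of "e / 3"] e by auto
    have "norm (J (lam n) x - x) < e" if "n \<ge> N" for n
    proof -
      interpret J: bounded_linear "J (lam n)" by (rule bounded_linear_J[OF lam(1)])
      have "norm (J (lam n) (x - y)) < e / 3"
        using norm_J[OF lam(1), of n "x - y"] y(2) by (simp add: dist_norm norm_minus_commute)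
      then show ?thesis
        using dist_triangle_third[of "J (lam n) x" "J (lam n) y" e y x] N[OF that] y(2)
        by (simp add: dist_norm J.diff)
    qed
    then show "\<exists>N. \<forall>n\<ge>N. norm (J (lam n) x - x) < e" by blast
  qed
qed

text \<open>\<open>Y\<close> commutes with its flow and is \<open>J\<close> after \<open>M\<close>
  on \<open>D\<close>, so the derivatives are approximate flows started at
  \<open>J (lam n) (M x)\<close>, which tends to \<open>M x\<close>.\<close>

lemma Y_uniform:
  assumes x: "x \<in> D"
  shows "uniform_limit {0..R} (\<lambda>n t. Y (lam n) (E (lam n) x t)) (U (M x)) sequentially"
proof (rule uniform_limitI)
  fix e :: real assume e: "e > 0"
  have "\<forall>\<^sub>F n in sequentially. dist (J (lam n) (M x)) (M x) < e / 2"
    using tendstoD[OF J_lim, of "e / 2"] e by simp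
  moreover have "\<forall>\<^sub>F n in sequentially. \<forall>t\<in>{0..R}. dist (E (lam n) (M x) t) (U (M x) t) < e / 2"
    using uniform_limitD[OF U_uniform[where R = R and x = "M x"], of "e / 2"] e by simp
  ultimately show "\<forall>\<^sub>F n in sequentially. \<forall>t\<in>{0..R}.
      dist (Y (lam n) (E (lam n) x t)) (U (M x) t) < e"
  proof eventually_elim
    case (elim n)
    show ?case
    proof
      fix t assume t: "t \<in> {0..R}"
      have "dist (Y (lam n) (E (lam n) x t)) (E (lam n) (M x) t) \<le> dist (J (lam n) (M x)) (M x)"
        using E_contraction[OF lam(1), of t n "Y (lam n) x" "M x"] t x lam(1)
        by (simp add: Y_E Y_on_D dist_norm)
      then show "dist (Y (lam n) (E (lam n) x t)) (U (M x) t) < e"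
        using elim t dist_triangle[of "Y (lam n) (E (lam n) x t)" "U (M x) t" "E (lam n) (M x) t"]
        by fastforce
    qed
  qed
qed

theorem solution_exists:
  assumes x: "x \<in> D"
  shows "\<exists>u. u 0 = x \<and> continuous_on {0..} (\<lambda>t. M (u t)) \<and>
    (\<forall>t\<ge>0. u t \<in> D \<and> (u has_vector_derivative M (u t)) (at t within {0..}))"
proof (intro exI conjI allI impI)
  have lim: "(\<lambda>n. E (lam n) y t) \<longlonglongrightarrow> U y t" if "t \<ge> 0" for t y
    using tendsto_uniform_limitI[OF U_uniform[where R = t and x = y], of t] that by simp
  show "U x 0 = x" using lim[of 0 x] E(1)[OF lam(1)] by (simp add: LIMSEQ_const_iff)
  have Ylim: "(\<lambda>n. Y (lam n) (E (lam n) x t)) \<longlonglongrightarrow> U (M x) t" if "t \<ge> 0" for t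
    using tendsto_uniform_limitI[OF Y_uniform[OF x, where R = t], of t] that by simp
  have U: "U x t \<in> D \<and> M (U x t) = U (M x) t" if t: "t \<ge> 0" for t
  proof -
    \<comment> \<open>This sum is the resolvent of the approximate solution. It lies in
      \<open>D\<close> and \<open>M\<close> maps it to the Yosida term, so the closed graph
      identifies \<open>M (U x t)\<close>.\<close>
    have "(\<lambda>n. E (lam n) x t + lam n *\<^sub>R Y (lam n) (E (lam n) x t)) \<longlonglongrightarrow> U x t + 0 *\<^sub>R U (M x) t"
      by (intro tendsto_intros lim Ylim lam t)
    then have "(\<lambda>n. J (lam n) (E (lam n) x t)) \<longlonglongrightarrow> U x t" using scaleR_Y[OF lam(1)] by simp
    then show ?thesis
      using closed_graph[of "\<lambda>n. J (lam n) (E (lam n) x t)"] J(1)[OF lam(1)] Ylim[OF t]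
      by (auto simp: Y_def)
  qed
  show "continuous_on {0..} (\<lambda>t. M (U x t))"
    by (rule continuous_on_eq[OF U_continuous[of "M x"]]) (use U in auto)
  fix t :: real assume t: "t \<ge> 0"
  show "U x t \<in> D" using U[OF t] by simp
  have "\<exists>g. \<forall>s\<in>{0..t+1}. (\<lambda>n. E (lam n) x s) \<longlonglongrightarrow> g s \<and>
      (g has_derivative (\<lambda>h. h *\<^sub>R U (M x) s)) (at s within {0..t+1})"
  proof (rule has_derivative_sequence[where f' = "\<lambda>n s h. h *\<^sub>R Y (lam n) (E (lam n) x s)" and ?x0.0 = 0])
    fix n s show "(E (lam n) x has_derivative (\<lambda>h. h *\<^sub>R Y (lam n) (E (lam n) x s))) (at s within {0..t+1})"
      using E(2)[OF lam(1)] by (simp add: has_vector_derivative_def)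
  next
    fix e :: real assume "e > 0"
    then have "\<forall>\<^sub>F n in sequentially. \<forall>s\<in>{0..t+1}. dist (Y (lam n) (E (lam n) x s)) (U (M x) s) < e"
      using Y_uniform[OF x] by (simp add: uniform_limit_iff)
    then show "\<forall>\<^sub>F n in sequentially. \<forall>s\<in>{0..t+1}. \<forall>h.
        norm (h *\<^sub>R Y (lam n) (E (lam n) x s) - h *\<^sub>R U (M x) s) \<le> e * norm h"
    proof eventually_elim
      case (elim n)
      have "\<bar>h\<bar> * norm (Y (lam n) (E (lam n) x s) - U (M x) s) \<le> \<bar>h\<bar> * e"
        if "s \<in> {0..t+1}" for s h
        using elim that by (intro mult_left_mono) (auto simp: dist_norm less_imp_le)
      then show ?case by (auto simp: mult.commute simp flip: scaleR_diff_right)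
    qed
  qed (use t lim[of 0 x] in auto)
  then obtain g where g: "\<And>s. s \<in> {0..t+1} \<Longrightarrow> (\<lambda>n. E (lam n) x s) \<longlonglongrightarrow> g s"
      "\<And>s. s \<in> {0..t+1} \<Longrightarrow> (g has_derivative (\<lambda>h. h *\<^sub>R U (M x) s)) (at s within {0..t+1})" by blast
  have gU: "g s = U x s" if "s \<in> {0..t+1}" for s
    using LIMSEQ_unique[OF g(1)[OF that] lim] that by auto
  have "(U x has_derivative (\<lambda>h. h *\<^sub>R U (M x) t)) (at t within {0..t+1})"
    by (rule has_derivative_transform[OF _ _ g(2)]) (use t gU in auto)
  moreover have "at t within {0..} = at t within {0..t+1}"
    by (rule at_within_nhd[of t "{t-1<..<t+1}"]) auto
  ultimately show "(U x has_vector_derivative M (U x t)) (at t within {0..})"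
    using U[OF t] by (simp add: has_vector_derivative_def)
qed

end


section \<open>Adjoints of bounded operators\<close>

instance complex_hilbert \<subseteq> banach ..

text \<open>The imaginary part is a real inner product with \<open>scaleC \<i> x\<close>, so an
  identity for \<open>cinner\<close> valid for all \<open>x\<close> in a complex subspace follows
  from its real part.\<close>

lemma cinner_eq_Complex: "cinner x y = Complex (inner x y) (inner (scaleC \<i> x) y)"
  by (simp add: complex_eq_iff inner_eq_Re_cinner cinner_scaleC_left)

text \<open>Riesz for the real inner product yields an adjoint; complex linearity of
  \<open>B\<close> lifts the identity to \<open>cinner\<close>, and nondegeneracy gives the
  uniqueness that \<open>THE\<close> in \<open>cadjoint\<close> requires.\<close>

lemma inner_cadjoint:
  assumes "bounded_clinear B"
  shows "inner (B x) y = inner x (cadjoint B y)"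
proof -
  interpret B: bounded_linear B using assms by (simp add: bounded_clinear_def)
  have "\<exists>z. \<forall>x. inner (B x) y = inner x z" for y
  proof -
    have "bounded_linear (\<lambda>x. inner (B x) y)"
      by (intro bounded_linear_inner_left_comp B.bounded_linear_axioms)
    from riesz_representation[OF this] show ?thesis by metis
  qed
  then obtain g where g: "\<And>x y. inner (B x) y = inner x (g y)" by metis
  have "\<exists>!g. \<forall>x y. cinner (B x) y = cinner x (g y)"
  proof (rule ex1I)
    have "B (scaleC \<i> x) = scaleC \<i> (B x)" for x using assms by (simp add: bounded_clinear_def)
    then show "\<forall>x y. cinner (B x) y = cinner x (g y)"
      using g by (metis cinner_eq_Complex)
  next
    fix h assume "\<forall>x y. cinner (B x) y = cinner x (h y)"
    then have "inner x (h y) = inner x (g y)" for x y using g by (metis inner_eq_Re_cinner)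
    then show "h = g" using vector_eq_ldot by blast
  qed
  then have "\<forall>x y. cinner (B x) y = cinner x (cadjoint B y)"
    unfolding cadjoint_def by (rule theI')
  then show ?thesis by (simp add: inner_eq_Re_cinner)
qed

lemma bounded_linear_cadjoint:
  assumes B: "bounded_clinear B"
  shows "bounded_linear (cadjoint B)"
proof -
  interpret B: bounded_linear B using assms by (simp add: bounded_clinear_def)
  obtain K where K: "\<And>x. norm (B x) \<le> norm x * K" "K \<ge> 0" using B.nonneg_bounded by blast
  note adj = inner_cadjoint[OF B, symmetric]
  show ?thesis
  proof (rule bounded_linear_intro[where K = K])
    fix x y show "cadjoint B (x + y) = cadjoint B x + cadjoint B y"
      by (subst vector_eq_ldot[symmetric]) (simp add: adj inner_add_right)
  next
    fix r x show "cadjoint B (r *\<^sub>R x) = r *\<^sub>R cadjoint B x"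
      by (subst vector_eq_ldot[symmetric]) (simp add: adj)
  next
    fix x show "norm (cadjoint B x) \<le> norm x * K"
    proof (cases "cadjoint B x = 0")
      case True
      then show ?thesis using K(2) by simp
    next
      case False
      let ?y = "cadjoint B x"
      have "norm ?y * norm ?y = inner (B ?y) x"
        by (simp add: inner_cadjoint[OF B] power2_norm_eq_inner[symmetric] power2_eq_square)
      also have "\<dots> \<le> norm (B ?y) * norm x" by (rule norm_cauchy_schwarz)
      also have "\<dots> \<le> norm ?y * K * norm x" by (intro mult_right_mono K(1)) simp
      finally show ?thesis using False by (simp add: mult.assoc mult.commute)
    qed
  qed
qed


section \<open>Self-adjoint operators\<close>

locale self_adjoint =
  fixes V :: "'x::complex_hilbert set" and S :: "'x \<Rightarrow> 'x"
  assumes self_adjoint: "self_adjoint_operator V S"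
begin

lemma linear_op: "linear_operator V S"
  using self_adjoint by (simp add: self_adjoint_operator_def)

lemma add: "x \<in> V \<Longrightarrow> y \<in> V \<Longrightarrow> S (x + y) = S x + S y"
  using linear_op by (simp add: linear_operator_def)

lemma scale: "x \<in> V \<Longrightarrow> S (c *\<^sub>R x) = c *\<^sub>R S x"
  using linear_op by (simp add: linear_operator_def flip: scaleC_of_real)

lemma subspace: "subspace V"
  using linear_op by (auto simp: linear_operator_def subspace_def simp flip: scaleC_of_real)

lemma zero: "S 0 = 0"
  using scale[of 0 0] subspace_0[OF subspace] by simp

lemma minus: "x \<in> V \<Longrightarrow> S (- x) = - S x"
  using scale[of x "-1"] by simp

lemma diff: "x \<in> V \<Longrightarrow> y \<in> V \<Longrightarrow> S (x - y) = S x - S y"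
  using add[of x "- y"] minus[of y] subspace by (simp add: subspace_neg)

lemma symmetric:
  assumes "x \<in> V" "y \<in> V"
  shows "inner (S x) y = inner x (S y)"
proof -
  have "(y, S y) \<in> adjoint_graph V S"
    using self_adjoint assms by (auto simp: self_adjoint_operator_def operator_graph_def)
  then show ?thesis using assms by (simp add: adjoint_graph_def inner_eq_Re_cinner)
qed

text \<open>Self-adjointness as a regularity principle: a weak identity against all of
  \<open>V\<close> puts \<open>y\<close> into the domain. The real identity suffices because it may
  also be tested at \<open>scaleC \<i> x\<close>.\<close>

lemma adjointI:
  assumes "\<And>x. x \<in> V \<Longrightarrow> inner (S x) y = inner x z"
  shows "y \<in> V" "S y = z"
proof -
  have "cinner (S x) y = cinner x z" if "x \<in> V" for x
  proof -
    have "scaleC \<i> x \<in> V" "S (scaleC \<i> x) = scaleC \<i> (S x)"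
      using linear_op that by (auto simp: linear_operator_def)
    then show ?thesis using assms that by (metis cinner_eq_Complex)
  qed
  then have "(y, z) \<in> adjoint_graph V S" by (simp add: adjoint_graph_def)
  then have "(y, z) \<in> operator_graph V S"
    using self_adjoint by (simp add: self_adjoint_operator_def)
  then show "y \<in> V" "S y = z" by (auto simp: operator_graph_def)
qed

lemma closed_graph:
  assumes "\<And>n. x n \<in> V" "x \<longlonglongrightarrow> a" "(\<lambda>n. S (x n)) \<longlonglongrightarrow> b"
  shows "a \<in> V" "S a = b"
proof -
  have "inner (S y) a = inner y b" if "y \<in> V" for y
  proof (rule LIMSEQ_unique)
    show "(\<lambda>n. inner (S y) (x n)) \<longlonglongrightarrow> inner (S y) a" by (intro tendsto_intros assms)
    have "(\<lambda>n. inner y (S (x n))) \<longlonglongrightarrow> inner y b" by (intro tendsto_intros assms)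
    then show "(\<lambda>n. inner (S y) (x n)) \<longlonglongrightarrow> inner y b" using symmetric that assms(1) by simp
  qed
  from adjointI[OF this] show "a \<in> V" "S a = b" by auto
qed

text \<open>The lower bound makes the range closed; a vector orthogonal to the range lies in the
  kernel by \<open>adjointI\<close>, and the kernel is trivial.\<close>

lemma bounded_below_surj:
  assumes m: "m > 0" "\<And>x. x \<in> V \<Longrightarrow> m * norm x \<le> norm (S x)"
  shows "S ` V = UNIV"
proof (rule closed_subspace_eq_UNIV)
  show "subspace (S ` V)"
    unfolding subspace_def
  proof (intro conjI ballI allI)
    show "0 \<in> S ` V" using zero subspace_0[OF subspace] by force
    fix a b assume "a \<in> S ` V" "b \<in> S ` V"
    then obtain x y where xy: "x \<in> V" "y \<in> V" "a = S x" "b = S y" by auto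
    then have "a + b = S (x + y)" by (simp add: add)
    then show "a + b \<in> S ` V" using xy subspace by (simp add: subspace_add)
  next
    fix c a assume "a \<in> S ` V"
    then obtain x where x: "x \<in> V" "a = S x" by auto
    then have "c *\<^sub>R a = S (c *\<^sub>R x)" by (simp add: scale)
    then show "c *\<^sub>R a \<in> S ` V" using x subspace by (simp add: subspace_scale)
  qed
  show "closed (S ` V)"
    unfolding closed_sequential_limits
  proof (intro allI impI)
    fix f l assume fl: "(\<forall>n. f n \<in> S ` V) \<and> f \<longlonglongrightarrow> l"
    then have "\<forall>n. \<exists>x. x \<in> V \<and> f n = S x" by blast
    then obtain x where x: "\<And>n. x n \<in> V" "\<And>n. f n = S (x n)" by metis
    have "Cauchy x"
    proof (rule CauchyI)
      fix e :: real assume "e > 0"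
      then obtain N where N: "\<And>i j. i \<ge> N \<Longrightarrow> j \<ge> N \<Longrightarrow> norm (f i - f j) < m * e"
        using CauchyD[OF LIMSEQ_imp_Cauchy, of f l "m * e"] fl m(1) by auto
      have "norm (x i - x j) < e" if "i \<ge> N" "j \<ge> N" for i j
      proof -
        have "m * norm (x i - x j) \<le> norm (f i - f j)"
          using m(2)[of "x i - x j"] x subspace by (simp add: diff subspace_diff)
        also have "\<dots> < m * e" using N that by simp
        finally show ?thesis using m(1) by simp
      qed
      then show "\<exists>N. \<forall>i\<ge>N. \<forall>j\<ge>N. norm (x i - x j) < e" by blast
    qed
    then obtain a where "x \<longlonglongrightarrow> a" using Cauchy_convergent convergent_def by blast
    moreover have "(\<lambda>n. S (x n)) \<longlonglongrightarrow> l" using fl by (simp flip: x(2))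
    ultimately have "a \<in> V" "S a = l" using closed_graph x(1) by blast+
    then show "l \<in> S ` V" by blast
  qed
  fix y assume "\<And>z. z \<in> S ` V \<Longrightarrow> inner z y = 0"
  then have "y \<in> V" "S y = 0" using adjointI[of y 0] by auto
  then show "y = 0" using m(1) m(2)[of y] by (simp add: mult_le_0_iff)
qed

end

text \<open>Positivity is given on \<open>DA\<close>, while the bound for \<open>S\<close> is wanted
  on all of \<open>V\<close>; therefore each \<open>x\<close> in \<open>V\<close> is represented as
  \<open>S a\<close> with \<open>a\<close> in \<open>DA\<close>.\<close>

lemma strictly_positive_sqrt_bound:
  assumes A: "self_adjoint_operator DA A" and S: "operator_sqrt DA A V S"
    and m: "m > 0" "\<And>x. x \<in> DA \<Longrightarrow> Re (cinner (A x) x) \<ge> m * (norm x)\<^sup>2"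
  shows "S ` V = UNIV" "\<And>x. x \<in> V \<Longrightarrow> m * (norm x)\<^sup>2 \<le> (norm (S x))\<^sup>2"
proof -
  interpret A: self_adjoint DA A by standard fact
  interpret S: self_adjoint V S by standard (use S in \<open>simp add: operator_sqrt_def\<close>)
  have DA: "x \<in> DA \<longleftrightarrow> x \<in> V \<and> S x \<in> V" and AS: "x \<in> DA \<Longrightarrow> A x = S (S x)" for x
    using S by (auto simp: operator_sqrt_def)
  have Abd: "m * norm x \<le> norm (A x)" if "x \<in> DA" for x
  proof (cases "x = 0")
    case False
    have "m * norm x * norm x \<le> inner (A x) x"
      using m(2)[OF that] by (simp add: inner_eq_Re_cinner power2_eq_square mult.assoc)
    also have "\<dots> \<le> norm (A x) * norm x" by (rule norm_cauchy_schwarz)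
    finally show ?thesis using False by simp
  qed (use A.zero in simp)
  then have surj: "A ` DA = UNIV" by (rule A.bounded_below_surj[OF m(1)])
  show "S ` V = UNIV"
  proof (intro set_eqI iffI UNIV_I)
    fix y :: 'a
    have "y \<in> A ` DA" using surj by simp
    then show "y \<in> S ` V" using DA AS by auto
  qed
  fix x assume x: "x \<in> V"
  \<comment> \<open>Solve \<open>A a = S x\<close>. Then \<open>S\<close> annihilates
    \<open>x - S a\<close>, hence so does \<open>A\<close>, so \<open>x = S a\<close>, and
    \<open>m * inner (A a) a\<close> can be bounded by \<open>(norm (A a))\<^sup>2\<close>.\<close>
  have "S x \<in> A ` DA" using surj by simp
  then obtain a where a: "a \<in> DA" "S x = A a" by auto
  have aV: "a \<in> V" "S a \<in> V" using a DA by auto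
  have "x - S a \<in> V" "S (x - S a) = 0"
    using a x aV AS S.subspace by (auto simp: S.diff subspace_diff)
  then have "x - S a \<in> DA" "A (x - S a) = 0" using DA AS S.zero subspace_0[OF S.subspace] by auto
  then have "x = S a" using Abd[of "x - S a"] m(1) by (simp add: mult_le_0_iff)
  have "m * (norm x)\<^sup>2 = m * inner (S a) (S a)" by (simp add: \<open>x = S a\<close> power2_norm_eq_inner)
  also have "\<dots> = m * inner (A a) a" using aV S.symmetric[of "S a" a] a AS by simp
  also have "\<dots> \<le> m * (norm (A a) * norm a)"
    using m(1) norm_cauchy_schwarz by (intro mult_left_mono) auto
  also have "\<dots> \<le> norm (A a) * norm (A a)"
    using mult_left_mono[OF Abd[OF a(1)], of "norm (A a)"] by (simp add: algebra_simps)
  finally show "m * (norm x)\<^sup>2 \<le> (norm (S x))\<^sup>2" by (simp add: a(2) power2_eq_square)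
qed


section \<open>The wave equation as a first-order system\<close>

lemma has_vector_derivative_shift:
  fixes f :: "real \<Rightarrow> 'a::real_normed_vector"
  assumes "(f has_vector_derivative f') (at (t + h) within {0..})" "h \<ge> 0"
  shows "((\<lambda>s. f (s + h)) has_vector_derivative f') (at t within {0..})"
proof -
  have "(f has_vector_derivative f') (at (t + h) within (\<lambda>s. s + h) ` {0..})"
    by (rule has_vector_derivative_within_subset[OF assms(1)]) (use assms(2) in auto)
  moreover have "((\<lambda>s. s + h) has_vector_derivative 1) (at t within {0..})"
    by (auto intro!: derivative_eq_intros)
  ultimately show ?thesis
    using vector_diff_chain_within[of "\<lambda>s. s + h" 1 t "{0..}" f f'] by (simp add: o_def)
qed

text \<open>Turns estimates for time increments into estimates for derivatives.\<close>

lemma has_vector_derivative_LIMSEQ: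
  fixes f :: "real \<Rightarrow> 'a::real_normed_vector"
  assumes "(f has_vector_derivative f') (at t within {0..})" "t \<ge> 0"
  shows "(\<lambda>n. real (Suc n) *\<^sub>R (f (t + 1 / real (Suc n)) - f t)) \<longlonglongrightarrow> f'"
proof -
  define X where "X n = t + 1 / real (Suc n)" for n
  have "((\<lambda>y. (1 / norm (y - t)) *\<^sub>R (f y - (f t + (y - t) *\<^sub>R f'))) \<longlongrightarrow> 0) (at t within {0..})"
    using assms(1) by (simp add: has_vector_derivative_def has_derivative_within)
  moreover have "\<forall>n. X n \<in> {0..} - {t}" using assms(2) by (auto simp: X_def)
  moreover have "X \<longlonglongrightarrow> t"
    using tendsto_add[OF tendsto_const LIMSEQ_inverse_real_of_nat, of t]
    by (simp add: X_def[abs_def] inverse_eq_divide)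
  ultimately have "(\<lambda>n. (1 / norm (X n - t)) *\<^sub>R (f (X n) - (f t + (X n - t) *\<^sub>R f'))) \<longlonglongrightarrow> 0"
    by (simp add: tendsto_at_iff_sequentially o_def)
  moreover have "(1 / norm (X n - t)) *\<^sub>R (f (X n) - (f t + (X n - t) *\<^sub>R f'))
      = real (Suc n) *\<^sub>R (f (t + 1 / real (Suc n)) - f t) - f'" for n
    by (simp add: X_def algebra_simps del: of_nat_Suc)
  ultimately have "(\<lambda>n. real (Suc n) *\<^sub>R (f (t + 1 / real (Suc n)) - f t) - f') \<longlonglongrightarrow> 0" by simp
  then show ?thesis by (rule LIM_zero_cancel)
qed

context self_adjoint
begin

definition gen :: "('x \<Rightarrow> 'x) \<Rightarrow> 'x \<times> 'x \<Rightarrow> 'x \<times> 'x" where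
  "gen K u = (S (snd u), - S (fst u) - K (snd u))"

text \<open>The two \<open>S\<close> terms cancel by symmetry: without \<open>K\<close> the
  generator is skew, and only the damping dissipates.\<close>

lemma inner_gen:
  assumes "u \<in> V \<times> V"
  shows "inner (gen K u) u = - inner (K (snd u)) (snd u)"
  using assms symmetric[of "fst u" "snd u"]
  by (auto simp: gen_def inner_prod_def inner_diff_left inner_diff_right inner_commute)

text \<open>The work is in the range condition: the range is closed by the resolvent estimate and
  the closed graph of \<open>S\<close>, and a vector orthogonal to it solves the adjoint equation,
  which has only the trivial solution.\<close>

lemma maximal_dissipative_gen:
  assumes K: "bounded_linear K" "\<And>x y. inner (K x) y = inner x (K y)" "\<And>x. inner (K x) x \<ge> 0"
  shows "maximal_dissipative (V \<times> V) (gen K)"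
proof -
  interpret K: bounded_linear K by fact
  have sub: "subspace (V \<times> V)" by (intro subspace_Times subspace)
  have ga: "gen K (x + y) = gen K x + gen K y" if "x \<in> V \<times> V" "y \<in> V \<times> V" for x y
    using that by (auto simp: gen_def add K.add)
  have gs: "gen K (c *\<^sub>R x) = c *\<^sub>R gen K x" if "x \<in> V \<times> V" for x c
    using that by (auto simp: gen_def scale K.scaleR scaleR_diff_right)
  have gd: "inner (gen K x) x \<le> 0" if "x \<in> V \<times> V" for x
    using inner_gen[OF that] K(3) by simp
  have surj: "(\<lambda>u. u - l *\<^sub>R gen K u) ` (V \<times> V) = UNIV" if l: "l > 0" for l
  proof (rule closed_subspace_eq_UNIV)
    let ?f = "\<lambda>u. u - l *\<^sub>R gen K u"
    have fa: "?f (x + y) = ?f x + ?f y" if "x \<in> V \<times> V" "y \<in> V \<times> V" for x y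
      using that by (simp add: ga algebra_simps)
    have fs: "?f (c *\<^sub>R x) = c *\<^sub>R ?f x" if "x \<in> V \<times> V" for x c
      using that by (simp add: gs algebra_simps)
    show "subspace (?f ` (V \<times> V))"
      unfolding subspace_def
    proof (intro conjI ballI allI)
      show "0 \<in> ?f ` (V \<times> V)"
        using fs[of 0 0] subspace_0[OF sub] by (intro image_eqI[of _ _ 0]) auto
      fix a b assume "a \<in> ?f ` (V \<times> V)" "b \<in> ?f ` (V \<times> V)"
      then obtain x y where "x \<in> V \<times> V" "y \<in> V \<times> V" "a = ?f x" "b = ?f y" by blast
      then show "a + b \<in> ?f ` (V \<times> V)"
        using fa[of x y] subspace_add[OF sub, of x y] by (intro image_eqI[of _ _ "x + y"]) auto
    next
      fix c a assume "a \<in> ?f ` (V \<times> V)"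
      then obtain x where "x \<in> V \<times> V" "a = ?f x" by blast
      then show "c *\<^sub>R a \<in> ?f ` (V \<times> V)"
        using fs[of x c] subspace_scale[OF sub, of x c] by (intro image_eqI[of _ _ "c *\<^sub>R x"]) auto
    qed
    show "closed (?f ` (V \<times> V))"
      unfolding closed_sequential_limits
    proof (intro allI impI)
      fix g L assume gL: "(\<forall>n. g n \<in> ?f ` (V \<times> V)) \<and> g \<longlonglongrightarrow> L"
      then have "\<forall>n. \<exists>x. x \<in> V \<times> V \<and> g n = ?f x" by blast
      then obtain x where x: "\<And>n. x n \<in> V \<times> V" "\<And>n. g n = ?f (x n)" by metis
      have "Cauchy x"
      proof (rule CauchyI)
        fix e :: real assume "e > 0"
        then obtain N where N: "\<And>i j. i \<ge> N \<Longrightarrow> j \<ge> N \<Longrightarrow> norm (g i - g j) < e"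
          using CauchyD[OF LIMSEQ_imp_Cauchy, of g L e] gL by auto
        have "norm (x i - x j) < e" if "i \<ge> N" "j \<ge> N" for i j
        proof -
          have d: "x i - x j \<in> V \<times> V" using x(1) sub by (intro subspace_diff)
          have "norm (x i - x j) \<le> norm (?f (x i - x j))"
            by (rule norm_le_dissipative_resolvent[OF gd[OF d] l])
          also have "?f (x i - x j) = g i - g j"
          proof -
            have "?f (x i - x j + x j) = ?f (x i - x j) + ?f (x j)" by (rule fa[OF d x(1)])
            then have "g i = ?f (x i - x j) + g j" by (simp only: diff_add_cancel x(2))
            then show ?thesis by (simp only: add_diff_cancel_right')
          qed
          finally show ?thesis using N[OF that] by simp
        qed
        then show "\<exists>N. \<forall>i\<ge>N. \<forall>j\<ge>N. norm (x i - x j) < e" by blast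
      qed
      then obtain a where a: "x \<longlonglongrightarrow> a" using Cauchy_convergent convergent_def by blast
      \<comment> \<open>\<open>gen K (x n)\<close> equals \<open>(x n - g n) / l\<close> and so
        converges to \<open>b\<close>; the closed graph of \<open>S\<close> then applies to each
        component.\<close>
      define b where "b = (1 / l) *\<^sub>R (a - L)"
      have "(\<lambda>n. (1 / l) *\<^sub>R (x n - g n)) \<longlonglongrightarrow> b"
        unfolding b_def using gL by (intro tendsto_intros a) auto
      moreover have "(1 / l) *\<^sub>R (x n - g n) = gen K (x n)" for n using l x(2)[of n] by simp
      ultimately have b: "(\<lambda>n. gen K (x n)) \<longlonglongrightarrow> b" by simp
      have 1: "(\<lambda>n. S (snd (x n))) \<longlonglongrightarrow> fst b" using tendsto_fst[OF b] by (simp add: gen_def)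
      have "(\<lambda>n. - snd (gen K (x n)) - K (snd (x n))) \<longlonglongrightarrow> - snd b - K (snd a)"
        by (intro tendsto_intros b a K.tendsto)
      then have 2: "(\<lambda>n. S (fst (x n))) \<longlonglongrightarrow> - snd b - K (snd a)" by (simp add: gen_def)
      have "fst (x n) \<in> V" "snd (x n) \<in> V" for n using x(1)[of n] by auto
      note cg = closed_graph[OF this(2) tendsto_snd[OF a] 1] closed_graph[OF this(1) tendsto_fst[OF a] 2]
      then have "a \<in> V \<times> V" by (simp add: mem_Times_iff)
      moreover have "gen K a = b" using cg by (simp add: gen_def prod_eq_iff)
      then have "?f a = L" using l by (simp add: b_def)
      ultimately show "L \<in> ?f ` (V \<times> V)" by blast
    qed
    fix z :: "'x \<times> 'x"
    assume z: "\<And>y. y \<in> ?f ` (V \<times> V) \<Longrightarrow> inner y z = 0"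
    obtain f g where fg: "z = (f, g)" by (cases z)
    have V0: "0 \<in> V" using subspace_0[OF subspace] .
    \<comment> \<open>Testing with \<open>(p, 0)\<close>, and below with \<open>(0, v)\<close>, puts
      both components of \<open>z\<close> into \<open>V\<close>.\<close>
    have "inner (S p) g = inner p (- (1 / l) *\<^sub>R f)" if "p \<in> V" for p
    proof -
      have "inner (?f (p, 0)) z = 0" using z that V0 by blast
      then have "inner p f + l * inner (S p) g = 0"
        by (simp add: fg gen_def zero K.zero inner_diff_left)
      then show ?thesis using l by (simp add: field_simps)
    qed
    from adjointI[OF this] have g: "g \<in> V" "S g = - (1 / l) *\<^sub>R f" by auto
    have "inner (S v) f = inner v ((1 / l) *\<^sub>R g + K g)" if "v \<in> V" for v
    proof -
      have "inner (?f (0, v)) z = 0" using z that V0 by blast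
      then have "inner v g + l * inner (K v) g - l * inner (S v) f = 0"
        by (simp add: fg gen_def zero inner_diff_left inner_add_left algebra_simps)
      then show ?thesis using l by (simp add: K(2) inner_add_right field_simps)
    qed
    from adjointI[OF this] have f: "f \<in> V" "S f = (1 / l) *\<^sub>R g + K g" by auto
    \<comment> \<open>Pairing the two equations through the symmetry of \<open>S\<close> equates a
      sum of nonnegative terms with a nonpositive one.\<close>
    have "(1 / l) * inner g g + inner (K g) g = - (1 / l) * inner f f"
      using symmetric[OF f(1) g(1)] by (simp add: f(2) g(2) inner_add_left)
    moreover have "(1 / l) * inner g g \<ge> 0" "(1 / l) * inner f f \<ge> 0" using l by auto
    ultimately have "(1 / l) * inner g g = 0" "(1 / l) * inner f f = 0"
      using K(3)[of g] by linarith+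
    then show "z = 0" using l by (simp add: fg zero_prod_def)
  qed
  have gr: "\<exists>x\<in>V \<times> V. x - l *\<^sub>R gen K x = y" if "l > 0" for l y
  proof -
    have "y \<in> (\<lambda>u. u - l *\<^sub>R gen K u) ` (V \<times> V)" using surj[OF that] by simp
    then obtain x where "y = x - l *\<^sub>R gen K x" "x \<in> V \<times> V" by (rule imageE)
    then show ?thesis by (intro bexI[of _ x]) simp_all
  qed
  show ?thesis using sub ga gs gd gr by unfold_locales
qed

section \<open>Trajectories of the first-order system\<close>

definition trajectory :: "('x \<Rightarrow> 'x) \<Rightarrow> (real \<Rightarrow> 'x) \<Rightarrow> (real \<Rightarrow> 'x) \<Rightarrow> bool" where
  "trajectory K p v \<longleftrightarrow> (\<forall>t\<ge>0. p t \<in> V \<and> v t \<in> V \<and>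
     (p has_vector_derivative S (v t)) (at t within {0..}) \<and>
     (v has_vector_derivative - S (p t) - K (v t)) (at t within {0..}))"

lemma trajectoryD:
  assumes "trajectory K p v" "t \<ge> 0"
  shows "p t \<in> V" "v t \<in> V" "(p has_vector_derivative S (v t)) (at t within {0..})"
    "(v has_vector_derivative - S (p t) - K (v t)) (at t within {0..})"
  using assms by (auto simp: trajectory_def)

lemma trajectory_exists:
  assumes K: "bounded_linear K" "\<And>x y. inner (K x) y = inner x (K y)" "\<And>x. inner (K x) x \<ge> 0"
    and "p0 \<in> V" "v0 \<in> V"
  obtains p v where "trajectory K p v" "p 0 = p0" "v 0 = v0"
    "continuous_on {0..} (\<lambda>t. S (v t))" "continuous_on {0..} (\<lambda>t. S (p t))"
proof -
  interpret M: maximal_dissipative "V \<times> V" "gen K" by (rule maximal_dissipative_gen[OF K])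
  interpret K: bounded_linear K by fact
  obtain u where u: "u 0 = (p0, v0)" "continuous_on {0..} (\<lambda>t. gen K (u t))"
      "\<And>t. t \<ge> 0 \<Longrightarrow> u t \<in> V \<times> V"
      "\<And>t. t \<ge> 0 \<Longrightarrow> (u has_vector_derivative gen K (u t)) (at t within {0..})"
    using M.solution_exists[of "(p0, v0)"] assms by auto
  note d = bounded_linear.has_vector_derivative[OF bounded_linear_fst u(4)]
    bounded_linear.has_vector_derivative[OF bounded_linear_snd u(4)]
  have t: "trajectory K (\<lambda>t. fst (u t)) (\<lambda>t. snd (u t))"
    using d u(3) by (auto simp: trajectory_def gen_def mem_Times_iff)
  have "continuous_on {0..} u" by (rule continuous_on_vector_derivative[OF u(4)]) simp
  then have "continuous_on {0..} (\<lambda>t. - snd (gen K (u t)) - K (snd (u t)))"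
    by (intro continuous_intros u(2) K.continuous_on)
  moreover have "continuous_on {0..} (\<lambda>t. fst (gen K (u t)))" by (intro continuous_intros u(2))
  ultimately show thesis using t u(1) by (intro that[OF t]) (auto simp: gen_def)
qed

lemma trajectory_shift:
  assumes "trajectory K p v" "h \<ge> 0"
  shows "trajectory K (\<lambda>t. p (t + h)) (\<lambda>t. v (t + h))"
  using assms unfolding trajectory_def by (auto intro!: has_vector_derivative_shift)

text \<open>\<open>u (t + h) - u t\<close> solves the same linear system in \<open>t\<close>, so its
  norm decreases; dividing by \<open>h\<close> and letting \<open>h\<close> tend to 0 transfers this
  to the derivative, which is \<open>gen K\<close> at the state.\<close>

lemma trajectory_gen_decreasing:
  assumes K: "bounded_linear K" "\<And>x. inner (K x) x \<ge> 0"
    and tr: "trajectory K p v" and t: "t \<ge> 0"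
  shows "norm (gen K (p t, v t)) \<le> norm (gen K (p 0, v 0))"
proof -
  interpret K: bounded_linear K by fact
  let ?u = "\<lambda>t. (p t, v t)"
  have d: "(?u has_vector_derivative gen K (?u s)) (at s within {0..})" if "s \<ge> 0" for s
    unfolding gen_def using trajectoryD(3,4)[OF tr that] by (auto intro: has_vector_derivative_Pair)
  have le: "norm (?u (t + h) - ?u t) \<le> norm (?u (0 + h) - ?u 0)" if h: "h \<ge> 0" for h
  proof (rule dissipative_norm_le[where z' = "\<lambda>s. gen K (?u (s + h)) - gen K (?u s)"])
    fix s :: real assume s: "s \<ge> 0"
    show "((\<lambda>s. ?u (s + h) - ?u s) has_vector_derivative gen K (?u (s + h)) - gen K (?u s)) (at s within {0..})"
      using has_vector_derivative_shift[OF d h, of s] d[OF s] s h by (intro has_vector_derivative_diff) auto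
    have in_V: "p (s + h) \<in> V" "v (s + h) \<in> V" "p s \<in> V" "v s \<in> V"
      using trajectoryD(1,2)[OF tr] s h by auto
    have "gen K (?u (s + h)) - gen K (?u s) = gen K (?u (s + h) - ?u s)"
      using in_V by (simp add: gen_def diff K.diff)
    then show "inner (gen K (?u (s + h)) - gen K (?u s)) (?u (s + h) - ?u s) \<le> 0"
      using inner_gen[of "?u (s + h) - ?u s" K] K(2) in_V subspace by (auto simp: subspace_diff)
  qed (use t in auto)
  show ?thesis
  proof (rule LIMSEQ_le)
    show "(\<lambda>n. norm (real (Suc n) *\<^sub>R (?u (t + 1 / real (Suc n)) - ?u t))) \<longlonglongrightarrow> norm (gen K (?u t))"
      by (intro tendsto_norm has_vector_derivative_LIMSEQ d t)
    show "(\<lambda>n. norm (real (Suc n) *\<^sub>R (?u (0 + 1 / real (Suc n)) - ?u 0))) \<longlonglongrightarrow> norm (gen K (?u 0))"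
      by (intro tendsto_norm has_vector_derivative_LIMSEQ d) auto
    show "\<exists>N. \<forall>n\<ge>N. norm (real (Suc n) *\<^sub>R (?u (t + 1 / real (Suc n)) - ?u t))
        \<le> norm (real (Suc n) *\<^sub>R (?u (0 + 1 / real (Suc n)) - ?u 0))"
      unfolding norm_scaleR by (intro exI[of _ 0] allI impI mult_left_mono le) auto
  qed
qed

end

section \<open>Comparison of the damped and the undamped flow\<close>

lemma inner_le_weighted:
  fixes x y :: "'a::real_inner"
  assumes e: "e > 0"
  shows "2 * inner x y \<le> (1 / e) * (norm x)\<^sup>2 + e * (norm y)\<^sup>2"
proof -
  have "0 \<le> (norm (x - e *\<^sub>R y))\<^sup>2" by simp
  then have "e * (2 * inner x y) \<le> (norm x)\<^sup>2 + e * (e * (norm y)\<^sup>2)"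
    unfolding power2_norm_eq_inner
    by (simp add: inner_diff_left inner_diff_right inner_commute algebra_simps)
  also have "\<dots> = e * ((1 / e) * (norm x)\<^sup>2 + e * (norm y)\<^sup>2)"
    using e by (simp add: distrib_left)
  finally show ?thesis using e by simp
qed

context self_adjoint
begin

lemma trajectory_continuous:
  assumes "trajectory K p v"
  shows "continuous_on {0..} p" "continuous_on {0..} v"
  by (rule continuous_on_vector_derivative[OF trajectoryD(3)[OF assms]], simp,
      rule continuous_on_vector_derivative[OF trajectoryD(4)[OF assms]], simp)

lemma trajectory_continuous_comp:
  assumes tr: "trajectory K p v" and C: "bounded_linear C"
  shows "continuous_on {0..T} (\<lambda>t. C (v t))"
  by (intro bounded_linear.continuous_on[OF C] continuous_on_subset[OF trajectory_continuous(2)[OF tr]]) auto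

lemma trajectory_energy_identity:
  assumes tr: "trajectory (\<lambda>x. B (C x)) p v"
    and adj: "\<And>x y. inner (B x) y = inner x (C y)" and T: "T \<ge> 0"
  shows "((\<lambda>t. 2 * (norm (C (v t)))\<^sup>2) has_integral
    ((norm (p 0))\<^sup>2 + (norm (v 0))\<^sup>2) - ((norm (p T))\<^sup>2 + (norm (v T))\<^sup>2)) {0..T}"
proof -
  let ?N = "\<lambda>t. - ((norm (p t))\<^sup>2 + (norm (v t))\<^sup>2)"
  have "(?N has_vector_derivative 2 * (norm (C (v t)))\<^sup>2) (at t within {0..T})" if "t \<in> {0..T}" for t
  proof -
    have t: "t \<ge> 0" using that by simp
    note trd = trajectoryD[OF tr t]
    have "(?N has_real_derivative
        - (2 * inner (S (v t)) (p t) + 2 * inner (- S (p t) - B (C (v t))) (v t))) (at t within {0..T})"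
      by (intro DERIV_minus DERIV_add has_real_derivative_norm_sq
          has_vector_derivative_within_subset[OF trd(3)] has_vector_derivative_within_subset[OF trd(4)]) auto
    moreover have "- (2 * inner (S (v t)) (p t) + 2 * inner (- S (p t) - B (C (v t))) (v t)) = 2 * (norm (C (v t)))\<^sup>2"
      using symmetric[OF trd(2,1)]
      by (simp add: inner_diff_left adj power2_norm_eq_inner inner_commute[of "v t"])
    ultimately show ?thesis by (simp add: has_real_derivative_iff_has_vector_derivative)
  qed
  from fundamental_theorem_of_calculus[OF T this] show ?thesis by (simp add: algebra_simps)
qed

text \<open>For the difference of the two systems the \<open>S\<close> terms cancel by symmetry,
  leaving only the damping of \<open>v\<close>, paired with \<open>v - r\<close>.\<close>

lemma trajectory_difference_identity:
  assumes tr: "trajectory (\<lambda>x. B (C x)) p v" "trajectory (\<lambda>x. 0) q r"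
    and init: "p 0 = q 0" "v 0 = r 0" and C: "bounded_linear C"
    and adj: "\<And>x y. inner (B x) y = inner x (C y)" and T: "T \<ge> 0"
  shows "((\<lambda>t. 2 * inner (C (v t)) (C (r t) - C (v t))) has_integral
    (norm (p T - q T))\<^sup>2 + (norm (v T - r T))\<^sup>2) {0..T}"
proof -
  interpret C: bounded_linear C by fact
  let ?N = "\<lambda>t. (norm (p t - q t))\<^sup>2 + (norm (v t - r t))\<^sup>2"
  have "(?N has_vector_derivative 2 * inner (C (v t)) (C (r t) - C (v t))) (at t within {0..T})"
    if "t \<in> {0..T}" for t
  proof -
    have t: "t \<ge> 0" using that by simp
    note trd = trajectoryD[OF tr(1) t] and trd' = trajectoryD[OF tr(2) t]
    let ?D = "2 * inner (S (v t) - S (r t)) (p t - q t)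
      + 2 * inner ((- S (p t) - B (C (v t))) - (- S (q t) - 0)) (v t - r t)"
    have "(?N has_real_derivative ?D) (at t within {0..T})"
      by (intro DERIV_add has_real_derivative_norm_sq has_vector_derivative_diff
          has_vector_derivative_within_subset[OF trd(3)] has_vector_derivative_within_subset[OF trd(4)]
          has_vector_derivative_within_subset[OF trd'(3)] has_vector_derivative_within_subset[OF trd'(4)]) auto
    moreover have "?D = 2 * inner (C (v t)) (C (r t) - C (v t))"
    proof -
      have "inner (S (v t - r t)) (p t - q t) = inner (v t - r t) (S (p t - q t))"
        using trd trd' subspace by (intro symmetric) (auto simp: subspace_diff)
      then have "inner (S (v t) - S (r t)) (p t - q t) = inner (S (p t) - S (q t)) (v t - r t)"
        using trd trd' by (simp add: diff inner_commute)
      moreover have "inner ((- S (p t) - B (C (v t))) - (- S (q t) - 0)) (v t - r t)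
          = - inner (S (p t) - S (q t)) (v t - r t) - inner (B (C (v t))) (v t - r t)"
        unfolding inner_diff_left by simp
      ultimately have "?D = - 2 * inner (B (C (v t))) (v t - r t)" by linarith
      then show ?thesis by (simp add: adj C.diff inner_diff_right)
    qed
    ultimately show ?thesis by (simp add: has_real_derivative_iff_has_vector_derivative)
  qed
  from fundamental_theorem_of_calculus[OF T this] show ?thesis using init by simp
qed

text \<open>Integrate \<open>2 * inner a (b - a) \<le> (norm b)\<^sup>2 - (norm a)\<^sup>2\<close>;
  by the difference identity the left side has a nonnegative integral.\<close>

lemma damped_observation_le:
  assumes tr: "trajectory (\<lambda>x. B (C x)) p v" "trajectory (\<lambda>x. 0) q r"
    and init: "p 0 = q 0" "v 0 = r 0" and C: "bounded_linear C"
    and adj: "\<And>x y. inner (B x) y = inner x (C y)" and T: "T \<ge> 0"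
  shows "integral {0..T} (\<lambda>t. (norm (C (v t)))\<^sup>2) \<le> integral {0..T} (\<lambda>t. (norm (C (r t)))\<^sup>2)"
proof -
  note c = trajectory_continuous_comp[OF tr(1) C, of T] trajectory_continuous_comp[OF tr(2) C, of T]
  have i: "((\<lambda>t. (norm (C (r t)))\<^sup>2 - (norm (C (v t)))\<^sup>2) has_integral
     integral {0..T} (\<lambda>t. (norm (C (r t)))\<^sup>2) - integral {0..T} (\<lambda>t. (norm (C (v t)))\<^sup>2)) {0..T}"
    by (intro has_integral_diff integrable_integral integrable_continuous_real continuous_intros c)
  have "(norm (p T - q T))\<^sup>2 + (norm (v T - r T))\<^sup>2
      \<le> integral {0..T} (\<lambda>t. (norm (C (r t)))\<^sup>2) - integral {0..T} (\<lambda>t. (norm (C (v t)))\<^sup>2)"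
  proof (rule has_integral_le[OF trajectory_difference_identity[OF assms] i])
    fix t
    have "(norm (C (r t) - C (v t)))\<^sup>2 \<ge> 0" by simp
    then show "2 * inner (C (v t)) (C (r t) - C (v t)) \<le> (norm (C (r t)))\<^sup>2 - (norm (C (v t)))\<^sup>2"
      by (simp add: power2_norm_eq_inner inner_diff_left inner_diff_right inner_commute)
  qed
  moreover have "(norm (p T - q T))\<^sup>2 + (norm (v T - r T))\<^sup>2 \<ge> 0" by simp
  ultimately show ?thesis by linarith
qed

text \<open>The maximum of \<open>N\<close>, the squared distance of the two flows, is estimated by
  the difference identity and Young's inequality, half of it being absorbed. This gives
  \<open>N s \<le> 4 * \<beta>\<^sup>2 * T * I\<close>, and
  \<open>2 * (norm (C (v t)))\<^sup>2 + 2 * \<beta>\<^sup>2 * N s\<close> integrates to the stated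
  constant.\<close>

lemma undamped_observation_le:
  assumes tr: "trajectory (\<lambda>x. B (C x)) p v" "trajectory (\<lambda>x. 0) q r"
    and init: "p 0 = q 0" "v 0 = r 0" and C: "bounded_linear C"
    and adj: "\<And>x y. inner (B x) y = inner x (C y)" and T: "T > 0"
    and \<beta>: "\<beta> > 0" "\<And>x. norm (C x) \<le> \<beta> * norm x"
  shows "integral {0..T} (\<lambda>t. (norm (C (r t)))\<^sup>2)
    \<le> (2 + 8 * \<beta> ^ 4 * T\<^sup>2) * integral {0..T} (\<lambda>t. (norm (C (v t)))\<^sup>2)"
proof -
  interpret C: bounded_linear C by fact
  note c = trajectory_continuous_comp[OF tr(1) C] trajectory_continuous_comp[OF tr(2) C]
  define I where "I = integral {0..T} (\<lambda>t. (norm (C (v t)))\<^sup>2)"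
  define N where "N t = (norm (p t - q t))\<^sup>2 + (norm (v t - r t))\<^sup>2" for t
  have int: "(\<lambda>t. (norm (C (v t)))\<^sup>2) integrable_on {0..t}" for t
    by (intro integrable_continuous_real continuous_intros c)
  have const: "((\<lambda>x. c) has_integral t * c) {0..t}" if "t \<ge> 0" for c t :: real
    using has_integral_const_real[of c 0 t] that by simp
  have "continuous_on {0..T} N"
    unfolding N_def
    by (intro continuous_intros continuous_on_subset[OF trajectory_continuous(1)[OF tr(1)]]
        continuous_on_subset[OF trajectory_continuous(2)[OF tr(1)]]
        continuous_on_subset[OF trajectory_continuous(1)[OF tr(2)]]
        continuous_on_subset[OF trajectory_continuous(2)[OF tr(2)]]) auto
  then obtain s where s: "s \<in> {0..T}" "\<And>t. t \<in> {0..T} \<Longrightarrow> N t \<le> N s"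
    using continuous_attains_sup[of "{0..T}" N] T by auto
  have Cd: "(norm (C (r t) - C (v t)))\<^sup>2 \<le> \<beta>\<^sup>2 * N s" if "t \<in> {0..T}" for t
  proof -
    have "(norm (C (r t) - C (v t)))\<^sup>2 \<le> (\<beta> * norm (v t - r t))\<^sup>2"
      using \<beta>(2)[of "v t - r t"] by (intro power_mono) (simp_all add: C.diff norm_minus_commute)
    also have "\<dots> \<le> \<beta>\<^sup>2 * N t" by (simp add: N_def power_mult_distrib mult_left_mono)
    also have "\<dots> \<le> \<beta>\<^sup>2 * N s" using s(2)[OF that] by (simp add: mult_left_mono)
    finally show ?thesis .
  qed
  \<comment> \<open>Chosen so that \<open>T * \<epsilon> * \<beta>\<^sup>2 = 1 / 2\<close>, which
    makes the term in \<open>N s\<close> absorbable.\<close>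
  define \<epsilon> where "\<epsilon> = 1 / (2 * \<beta>\<^sup>2 * T)"
  have \<epsilon>: "\<epsilon> > 0" using \<beta> T by (simp add: \<epsilon>_def)
  have Ns0: "N s \<ge> 0" by (simp add: N_def)
  have "N s \<le> s * (\<epsilon> * (\<beta>\<^sup>2 * N s)) + (1 / \<epsilon>) * integral {0..s} (\<lambda>t. (norm (C (v t)))\<^sup>2)"
    unfolding N_def
  proof (rule has_integral_le[OF trajectory_difference_identity[OF tr init C adj]])
    show "((\<lambda>t. \<epsilon> * (\<beta>\<^sup>2 * N s) + (1 / \<epsilon>) * (norm (C (v t)))\<^sup>2) has_integral
      s * (\<epsilon> * (\<beta>\<^sup>2 * ((norm (p s - q s))\<^sup>2 + (norm (v s - r s))\<^sup>2)))
        + (1 / \<epsilon>) * integral {0..s} (\<lambda>t. (norm (C (v t)))\<^sup>2)) {0..s}"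
      unfolding N_def using s(1)
      by (intro has_integral_add has_integral_mult_right integrable_integral int)
        (use const in auto)
    fix t assume "t \<in> {0..s}"
    then have t: "t \<in> {0..T}" using s(1) by auto
    let ?x = "C (v t)" and ?y = "C (r t) - C (v t)"
    have "2 * inner ?x ?y \<le> (1 / \<epsilon>) * (norm ?x)\<^sup>2 + \<epsilon> * (norm ?y)\<^sup>2"
      by (rule inner_le_weighted[OF \<epsilon>])
    also have "\<epsilon> * (norm ?y)\<^sup>2 \<le> \<epsilon> * (\<beta>\<^sup>2 * N s)" using \<epsilon> Cd[OF t] by (intro mult_left_mono) auto
    finally show "2 * inner ?x ?y \<le> \<epsilon> * (\<beta>\<^sup>2 * N s) + (1 / \<epsilon>) * (norm ?x)\<^sup>2" by linarith
  qed (use s in auto)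
  also have "\<dots> \<le> T * (\<epsilon> * (\<beta>\<^sup>2 * N s)) + (1 / \<epsilon>) * I"
    unfolding I_def using s(1) \<epsilon> Ns0 int
    by (intro add_mono mult_left_mono integral_subset_le) (auto intro: mult_right_mono)
  also have "\<dots> = N s / 2 + 2 * \<beta>\<^sup>2 * T * I" using \<beta> T by (simp add: \<epsilon>_def field_simps)
  finally have Ns: "N s \<le> 4 * \<beta>\<^sup>2 * T * I" by simp
  have "integral {0..T} (\<lambda>t. (norm (C (r t)))\<^sup>2) \<le> 2 * I + T * (8 * \<beta> ^ 4 * T * I)"
  proof (rule has_integral_le)
    show "((\<lambda>t. (norm (C (r t)))\<^sup>2) has_integral integral {0..T} (\<lambda>t. (norm (C (r t)))\<^sup>2)) {0..T}"
      by (intro integrable_integral integrable_continuous_real continuous_intros c)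
    show "((\<lambda>t. 2 * (norm (C (v t)))\<^sup>2 + 8 * \<beta> ^ 4 * T * I) has_integral
        2 * I + T * (8 * \<beta> ^ 4 * T * I)) {0..T}"
      unfolding I_def
      by (intro has_integral_add has_integral_mult_right integrable_integral int)
        (use const T in auto)
    fix t assume t: "t \<in> {0..T}"
    let ?x = "C (v t)" and ?y = "C (r t) - C (v t)"
    have "0 \<le> (norm (?x - ?y))\<^sup>2" by simp
    then have "(norm (?x + ?y))\<^sup>2 \<le> 2 * (norm ?x)\<^sup>2 + 2 * (norm ?y)\<^sup>2"
      unfolding power2_norm_eq_inner by (simp add: inner_simps inner_commute)
    also have "(norm ?y)\<^sup>2 \<le> \<beta>\<^sup>2 * (4 * \<beta>\<^sup>2 * T * I)"
      using Cd[OF t] mult_left_mono[OF Ns, of "\<beta>\<^sup>2"] by simp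
    also have "2 * (norm ?x)\<^sup>2 + 2 * (\<beta>\<^sup>2 * (4 * \<beta>\<^sup>2 * T * I)) = 2 * (norm ?x)\<^sup>2 + 8 * \<beta> ^ 4 * T * I"
      by (simp add: power4_eq_xxxx power2_eq_square)
    finally show "(norm (C (r t)))\<^sup>2 \<le> 2 * (norm ?x)\<^sup>2 + 8 * \<beta> ^ 4 * T * I" by simp
  qed
  also have "\<dots> = (2 + 8 * \<beta> ^ 4 * T\<^sup>2) * I" by (simp add: power2_eq_square algebra_simps)
  finally show ?thesis by (simp add: I_def)
qed

end

section \<open>Passing between trajectories and solutions of the wave equation\<close>

lemma tderivI:
  assumes "(w has_vector_derivative d) (at t within {0..})" "t \<ge> 0"
  shows "tderiv w t = d"
  unfolding tderiv_def
proof (rule vector_derivative_within[OF _ assms(1)])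
  have "t islimpt {t<..<t+1}" by (simp add: islimpt_greaterThanLessThan1)
  then have "t islimpt {0..}" by (rule islimpt_subset) (use assms(2) in auto)
  then show "at t within {0..} \<noteq> bot" by (simp add: trivial_limit_within)
qed

lemma wave_solution_trajectory:
  assumes S: "operator_sqrt DA A V S" and w: "wave_solution DA A V S K w0 w1 w"
  shows "self_adjoint.trajectory V S K (\<lambda>t. S (w t)) (tderiv w)"
proof -
  interpret S: self_adjoint V S by standard (use S in \<open>simp add: operator_sqrt_def\<close>)
  show ?thesis
    unfolding S.trajectory_def
  proof (intro allI impI conjI)
    fix t :: real assume t: "t \<ge> 0"
    have "w t \<in> DA" using w t by (simp add: wave_solution_def)
    then show "S (w t) \<in> V" using S by (simp add: operator_sqrt_def)
    have "A (w t) = S (S (w t))" using S \<open>w t \<in> DA\<close> by (simp add: operator_sqrt_def)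
    moreover have "tderiv (tderiv w) t + A (w t) + K (tderiv w t) = 0"
      using w t by (simp add: wave_solution_def)
    ultimately have "tderiv (tderiv w) t = - (S (S (w t)) + K (tderiv w t))"
      by (simp only: eq_neg_iff_add_eq_0 add.assoc)
    then have "tderiv (tderiv w) t = - S (S (w t)) - K (tderiv w t)" by simp
    moreover have "(tderiv w has_vector_derivative tderiv (tderiv w) t) (at t within {0..})"
      using w t by (simp add: wave_solution_def)
    ultimately show "(tderiv w has_vector_derivative - S (S (w t)) - K (tderiv w t)) (at t within {0..})"
      by simp
  qed (use w in \<open>auto simp: wave_solution_def\<close>)
qed

text \<open>A trajectory determines \<open>w\<close> as the inverse of \<open>S\<close> applied to
  \<open>p\<close>. Since \<open>S\<close> is onto and bounded below, this inverse is bounded and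
  commutes with differentiation, so \<open>w' = v\<close>.\<close>

lemma wave_solution_exists:
  assumes S: "operator_sqrt DA A V S" and surj: "S ` V = UNIV"
    and m: "m > 0" "\<And>x. x \<in> V \<Longrightarrow> m * (norm x)\<^sup>2 \<le> (norm (S x))\<^sup>2"
    and K: "bounded_linear K" "\<And>x y. inner (K x) y = inner x (K y)" "\<And>x. inner (K x) x \<ge> 0"
    and w01: "w0 \<in> DA" "w1 \<in> V"
  shows "\<exists>w. wave_solution DA A V S K w0 w1 w"
proof -
  interpret S: self_adjoint V S by standard (use S in \<open>simp add: operator_sqrt_def\<close>)
  interpret K: bounded_linear K by fact
  have DA: "x \<in> DA \<longleftrightarrow> x \<in> V \<and> S x \<in> V" and AS: "x \<in> DA \<Longrightarrow> A x = S (S x)" for x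
    using S by (auto simp: operator_sqrt_def)
  have inj: "inj_on S V"
  proof (rule inj_onI)
    fix x y assume xy: "x \<in> V" "y \<in> V" "S x = S y"
    then have "m * (norm (x - y))\<^sup>2 \<le> 0"
      using m(2)[of "x - y"] S.subspace by (simp add: S.diff subspace_diff)
    then show "x = y" using m(1) by (simp add: mult_le_0_iff)
  qed
  define T where "T = inv_into V S"
  have T: "T y \<in> V" "S (T y) = y" for y
    using surj by (auto simp: T_def inv_into_into f_inv_into_f)
  have TS: "T (S x) = x" if "x \<in> V" for x using inj that by (simp add: T_def)
  have "bounded_linear T"
  proof (rule bounded_linear_intro[where K = "1 / sqrt m"])
    fix x y
    show "T (x + y) = T x + T y"
      using TS[of "T x + T y"] T S.subspace by (simp add: S.add subspace_add)
  next
    fix c x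
    show "T (c *\<^sub>R x) = c *\<^sub>R T x"
      using TS[of "c *\<^sub>R T x"] T S.subspace by (simp add: S.scale subspace_scale)
  next
    fix x
    have "(sqrt m * norm (T x))\<^sup>2 \<le> (norm x)\<^sup>2" using m(2)[OF T(1)] m(1) by (simp add: power_mult_distrib T)
    then have "sqrt m * norm (T x) \<le> norm x" by (rule power2_le_imp_le) simp
    then show "norm (T x) \<le> norm x * (1 / sqrt m)" using m(1) by (simp add: field_simps)
  qed
  then interpret T: bounded_linear T .
  have w0: "w0 \<in> V" "S w0 \<in> V" using DA w01 by auto
  obtain p v where tr: "S.trajectory K p v" and init: "p 0 = S w0" "v 0 = w1"
      and cont: "continuous_on {0..} (\<lambda>t. S (v t))" "continuous_on {0..} (\<lambda>t. S (p t))"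
    using S.trajectory_exists[OF K w0(2) w01(2)] by blast
  define w where "w t = T (p t)" for t
  have wd: "(w has_vector_derivative v t) (at t within {0..})" if "t \<ge> 0" for t
    using T.has_vector_derivative[OF S.trajectoryD(3)[OF tr that]] S.trajectoryD(2)[OF tr that]
    by (simp add: w_def[abs_def] TS)
  have wt: "tderiv w t = v t" if "t \<ge> 0" for t using tderivI[OF wd[OF that] that] .
  have vd: "(tderiv w has_vector_derivative - S (p t) - K (v t)) (at t within {0..})" if "t \<ge> 0" for t
    by (rule has_vector_derivative_transform[OF _ _ S.trajectoryD(4)[OF tr that]]) (use that wt in auto)
  have vt: "tderiv (tderiv w) t = - S (p t) - K (v t)" if "t \<ge> 0" for t
    using tderivI[OF vd[OF that] that] .
  have wDA: "w t \<in> DA" "A (w t) = S (p t)" if "t \<ge> 0" for t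
    using T S.trajectoryD(1)[OF tr that] DA AS[of "w t"] by (auto simp: w_def)
  have "wave_solution DA A V S K w0 w1 w"
    unfolding wave_solution_def
  proof (intro conjI allI impI)
    show "continuous_on {0..} (\<lambda>t. A (w t))" by (rule continuous_on_eq[OF cont(2)]) (simp add: wDA)
    show "continuous_on {0..} (\<lambda>t. S (tderiv w t))" by (rule continuous_on_eq[OF cont(1)]) (simp add: wt)
    have "continuous_on {0..} (\<lambda>t. - S (p t) - K (v t))"
      by (intro continuous_intros cont K.continuous_on S.trajectory_continuous(2)[OF tr])
    then show "continuous_on {0..} (tderiv (tderiv w))"
      by (rule continuous_on_eq) (simp add: vt)
    show "w 0 = w0" using init w0 by (simp add: w_def TS)
    show "tderiv w 0 = w1" using wt init by simp
    fix t :: real assume t: "t \<ge> 0"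
    show "w t \<in> DA" using wDA t by simp
    show "tderiv w t \<in> V" using wt[OF t] S.trajectoryD(2)[OF tr t] by simp
    show "(w has_vector_derivative tderiv w t) (at t within {0..})" using wd t wt by simp
    show "((\<lambda>s. S (w s)) has_vector_derivative S (tderiv w t)) (at t within {0..})"
      using S.trajectoryD(3)[OF tr t] wt[OF t] by (simp add: w_def T)
    show "(tderiv w has_vector_derivative tderiv (tderiv w) t) (at t within {0..})"
      using vd vt t by simp
    show "tderiv (tderiv w) t + A (w t) + K (tderiv w t) = 0" using t by (simp add: vt wDA wt)
  qed
  then show ?thesis by blast
qed


section \<open>A discrete decay inequality\<close>

locale increasing_bijection =
  fixes G :: "real \<Rightarrow> real"
  assumes cont: "continuous_on {0..} G" and mono: "strict_mono_on {0..} G"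
    and bij: "bij_betw G {0..} {0..}"
begin

lemma less: "0 \<le> x \<Longrightarrow> x < y \<Longrightarrow> G x < G y"
  using mono by (auto simp: strict_mono_on_def)

lemma le: "0 \<le> x \<Longrightarrow> x \<le> y \<Longrightarrow> G x \<le> G y"
  using less[of x y] by (cases "x = y") auto

lemma nonneg: "0 \<le> x \<Longrightarrow> 0 \<le> G x"
  using bij by (auto simp: bij_betw_def)

lemma surj: "0 \<le> y \<Longrightarrow> \<exists>x\<ge>0. G x = y"
  using bij by (force simp: bij_betw_def image_iff)

lemma pos: "0 < x \<Longrightarrow> 0 < G x"
  using less[of 0 x] nonneg[of 0] by simp

lemma inv: "0 \<le> x \<Longrightarrow> inv_into {0..} G (G x) = x"
  using bij by (simp add: bij_betw_def)

lemma weighted_inverse: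
  assumes F: "\<And>x. 0 \<le> x \<Longrightarrow> F x = x * (G x)\<^sup>2" and y: "0 \<le> y"
  shows "0 \<le> inv_into {0..} F y" "F (inv_into {0..} F y) = y"
proof -
  obtain x1 where x1: "x1 \<ge> 0" "G x1 = 1" using surj[of 1] by auto
  \<comment> \<open>\<open>M \<ge> x1\<close> gives \<open>G M \<ge> 1\<close>, so
    \<open>M * (G M)\<^sup>2 \<ge> M \<ge> y\<close> and the intermediate value theorem applies on
    \<open>[0, M]\<close>.\<close>
  define M where "M = max x1 y"
  have M: "M \<ge> 0" "M \<ge> x1" "M \<ge> y" using x1 by (auto simp: M_def)
  have "1 \<le> (G M)\<^sup>2" using le[OF x1(1) M(2)] x1(2) by (simp add: one_le_power)
  then have "y \<le> M * (G M)\<^sup>2" using M mult_left_mono[of 1 "(G M)\<^sup>2" M] by linarith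
  moreover have "continuous_on {0..M} (\<lambda>x. x * (G x)\<^sup>2)"
    by (intro continuous_intros continuous_on_subset[OF cont]) auto
  ultimately obtain x where "0 \<le> x" "x * (G x)\<^sup>2 = y"
    using IVT'[of "\<lambda>x. x * (G x)\<^sup>2" 0 y M] y M(1) by auto
  then have "y \<in> F ` {0..}" using F by force
  then show "0 \<le> inv_into {0..} F y" "F (inv_into {0..} F y) = y"
    using inv_into_into[of y F "{0..}"] by (auto simp: f_inv_into_f)
qed

text \<open>Since \<open>x \<mapsto> F x / x\<close> is increasing, \<open>F (k * z) \<ge> k * F z\<close>: a constant inside the inverse of
  \<open>F\<close> can be moved outside.\<close>

lemma le_weighted_inverse:
  assumes F: "\<And>x. 0 \<le> x \<Longrightarrow> F x = x * (G x)\<^sup>2" and y: "0 \<le> y" and k: "1 \<le> k"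
    and x: "0 \<le> x" "x * (G x)\<^sup>2 \<le> k * y"
  shows "x \<le> k * inv_into {0..} F y"
proof (rule ccontr)
  define z where "z = inv_into {0..} F y"
  have z: "0 \<le> z" "z * (G z)\<^sup>2 = y" using weighted_inverse[OF F y] F by (auto simp: z_def)
  assume "\<not> x \<le> k * inv_into {0..} F y"
  then have kz: "k * z < x" by (simp add: z_def)
  have zx: "z \<le> k * z" using z(1) k mult_right_mono[of 1 k z] by simp
  then have "z < x" using kz by simp
  then have "(G z)\<^sup>2 \<le> (G x)\<^sup>2" "0 < G x" using le[of z x] nonneg[of z] pos[of x] z(1) by (auto intro: power_mono)
  then have "k * z * (G z)\<^sup>2 \<le> k * z * (G x)\<^sup>2" "k * z * (G x)\<^sup>2 < x * (G x)\<^sup>2"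
    using kz zx z(1) k by (auto intro!: mult_left_mono mult_strict_right_mono)
  then have "k * y < x * (G x)\<^sup>2" using z(2) by (simp add: mult.assoc)
  with x(2) show False by simp
qed

text \<open>Freezing the step length at its value at the final time gives \<open>t * x * G x ^ 3 \<le> \<kappa> * M\<close> with
  \<open>x = e t\<close>; the claim only needs this multiplied by the bounded quantity \<open>x * G x\<close>.\<close>

lemma decay_of_step_inequality:
  assumes anti: "\<And>s t. 0 \<le> s \<Longrightarrow> s \<le> t \<Longrightarrow> e t \<le> e s"
    and nonneg_e: "\<And>s. 0 \<le> s \<Longrightarrow> 0 \<le> e s" and M: "e 0 \<le> M" and \<kappa>: "\<kappa> > 0"
    and step: "\<And>s. 0 \<le> s \<Longrightarrow> 0 < e s \<Longrightarrow> e s * (G (e s))\<^sup>2 \<le> \<kappa> * (e s - e (s + 1 / G (e s)))"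
    and t: "t > 0"
  shows "e t * (G (e t))\<^sup>2 \<le> sqrt (M * G M * (\<kappa> * M)) * (1 / sqrt t)"
proof (cases "e t = 0")
  case True
  have "0 \<le> M" using nonneg_e[of 0] M by simp
  then show ?thesis using True nonneg[of M] \<kappa> t by simp
next
  case False
  define x where "x = e t"
  define \<tau> where "\<tau> = 1 / G x"
  have x: "x > 0" using False nonneg_e[of t] t by (simp add: x_def)
  have Gx: "G x > 0" using pos[OF x] .
  have \<tau>: "\<tau> > 0" using Gx by (simp add: \<tau>_def)
  have xM: "x \<le> M" using anti[of 0 t] M t by (simp add: x_def)
  have GM: "G x \<le> G M" using le[of x M] x xM by simp
  have step': "x * (G x)\<^sup>2 \<le> \<kappa> * (e s - e (s + \<tau>))" if s: "0 \<le> s" "s \<le> t" for s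
  proof -
    have xs: "x \<le> e s" using anti[OF s] by (simp add: x_def)
    have G1: "G x \<le> G (e s)" using le[of x "e s"] x xs by simp
    then have "1 / G (e s) \<le> \<tau>" using Gx by (simp add: \<tau>_def frac_le)
    moreover have "0 \<le> 1 / G (e s)" using G1 Gx by simp
    ultimately have "e (s + \<tau>) \<le> e (s + 1 / G (e s))" using s by (intro anti) auto
    then have "\<kappa> * (e s - e (s + 1 / G (e s))) \<le> \<kappa> * (e s - e (s + \<tau>))" using \<kappa> by simp
    moreover have "x * (G x)\<^sup>2 \<le> e s * (G (e s))\<^sup>2"
      using x xs G1 Gx by (intro mult_mono power_mono) auto
    ultimately show ?thesis using step[OF s(1)] x xs by linarith
  qed
  have tele: "(\<forall>i<n. real i * \<tau> \<le> t) \<Longrightarrow> real n * (x * (G x)\<^sup>2) \<le> \<kappa> * (e 0 - e (real n * \<tau>))" for n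
  proof (induction n)
    case (Suc n)
    then have "real n * (x * (G x)\<^sup>2) \<le> \<kappa> * (e 0 - e (real n * \<tau>))" "real n * \<tau> \<le> t" by auto
    with step'[of "real n * \<tau>"] \<tau> show ?case by (simp add: algebra_simps)
  qed simp
  \<comment> \<open>\<open>n\<close> steps of length \<open>\<tau>\<close> reach \<open>t\<close>,
    while the last of them starts no later than \<open>t\<close>, where \<open>step'\<close> still
    applies.\<close>
  define n where "n = nat \<lfloor>t / \<tau>\<rfloor> + 1"
  have n: "t / \<tau> \<le> real n" using t \<tau> by (simp add: n_def) linarith
  have "real i * \<tau> \<le> t" if "i < n" for i
  proof -
    have "0 \<le> \<lfloor>t / \<tau>\<rfloor>" using t \<tau> by simp
    then have "int i \<le> \<lfloor>t / \<tau>\<rfloor>" using that unfolding n_def by linarith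
    then have "real i \<le> t / \<tau>" by linarith
    then show ?thesis using \<tau> by (simp add: field_simps)
  qed
  then have "real n * (x * (G x)\<^sup>2) \<le> \<kappa> * (e 0 - e (real n * \<tau>))" by (intro tele) auto
  also have "\<dots> \<le> \<kappa> * M" using nonneg_e[of "real n * \<tau>"] \<tau> M \<kappa> by (intro mult_left_mono) auto
  finally have rate: "t / \<tau> * (x * (G x)\<^sup>2) \<le> \<kappa> * M"
    using mult_right_mono[OF n, of "x * (G x)\<^sup>2"] x by simp
  have "x * G x \<le> M * G M" using x xM Gx GM by (intro mult_mono) auto
  \<comment> \<open>Since \<open>1 / \<tau> = G x\<close>, the left side is
    \<open>t * (x * (G x)\<^sup>2)\<^sup>2\<close>, and a square root gives the claim.\<close>
  then have "x * G x * (t / \<tau> * (x * (G x)\<^sup>2)) \<le> M * G M * (\<kappa> * M)"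
    by (rule mult_mono[OF _ rate]) (use x xM Gx GM t \<tau> in auto)
  then have "(x * (G x)\<^sup>2 * sqrt t)\<^sup>2 \<le> M * G M * (\<kappa> * M)"
    using t by (simp add: \<tau>_def power_mult_distrib power2_eq_square algebra_simps)
  then have "x * (G x)\<^sup>2 * sqrt t \<le> sqrt (M * G M * (\<kappa> * M))" by (rule real_le_rsqrt)
  then show ?thesis using t by (simp add: x_def field_simps)
qed

end


section \<open>Decay and observability\<close>

locale damped_wave = self_adjoint V S
  for V :: "'x::complex_hilbert set" and S +
  fixes DA A and B :: "'u::complex_hilbert \<Rightarrow> 'x" and m :: real
  assumes sqrt_A: "operator_sqrt DA A V S" and B: "bounded_clinear B" and m: "m > 0"
    and surj: "S ` V = UNIV" and S_bound: "\<And>x. x \<in> V \<Longrightarrow> m * (norm x)\<^sup>2 \<le> (norm (S x))\<^sup>2"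
begin

definition C where "C = cadjoint B"

lemma C: "bounded_linear C" "inner (B x) y = inner x (C y)"
  using bounded_linear_cadjoint[OF B] inner_cadjoint[OF B] by (auto simp: C_def)

lemma damping: "bounded_linear (\<lambda>x. B (C x))" "inner (B (C x)) y = inner x (B (C y))"
  "inner (B (C x)) x \<ge> 0"
proof -
  have "bounded_linear B" using B by (simp add: bounded_clinear_def)
  from bounded_linear_compose[OF this C(1)] show "bounded_linear (\<lambda>x. B (C x))" .
  show "inner (B (C x)) y = inner x (B (C y))" using C(2) by (metis inner_commute)
  show "inner (B (C x)) x \<ge> 0" using C(2) by simp
qed

lemma in_DA: "x \<in> DA \<longleftrightarrow> x \<in> V \<and> S x \<in> V" "x \<in> DA \<Longrightarrow> A x = S (S x)"
  using sqrt_A by (auto simp: operator_sqrt_def)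

text \<open>In other words \<open>Lambda\<close> is at least \<open>m\<close>; in the decay proof
  this bounds the normalised initial energy independently of the data.\<close>

lemma sqnorm_DV_ge:
  assumes "w0 \<in> DA" "w1 \<in> V"
  shows "m * sqnorm_VX S w0 w1 \<le> sqnorm_DV A S w0 w1"
  using S_bound[of "S w0"] S_bound[of w1] assms in_DA
  by (auto simp: sqnorm_VX_def sqnorm_DV_def distrib_left add_mono)

lemma sqnorm_VX_pos:
  assumes "w0 \<in> DA" "w1 \<in> V" "(w0, w1) \<noteq> (0, 0)"
  shows "sqnorm_VX S w0 w1 > 0"
proof (rule ccontr)
  assume "\<not> sqnorm_VX S w0 w1 > 0"
  then have "(norm (S w0))\<^sup>2 + (norm w1)\<^sup>2 \<le> 0" by (simp add: sqnorm_VX_def)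
  then have "(norm (S w0))\<^sup>2 = 0" "(norm w1)\<^sup>2 = 0"
    using zero_le_power2[of "norm (S w0)"] zero_le_power2[of "norm w1"] by linarith+
  then have "S w0 = 0" "w1 = 0" by auto
  moreover have "m * (norm w0)\<^sup>2 \<le> (norm (S w0))\<^sup>2" using S_bound assms(1) in_DA by simp
  ultimately show False using m assms(3) by (simp add: mult_le_0_iff)
qed

lemma undamped_exists:
  assumes "w0 \<in> DA" "w1 \<in> V"
  shows "\<exists>\<phi>. undamped_solution DA A V S w0 w1 \<phi>"
  unfolding undamped_solution_def
  using wave_solution_exists[OF sqrt_A surj m S_bound, of "\<lambda>x. 0"] assms by simp

lemma damped_exists:
  assumes "w0 \<in> DA" "w1 \<in> V"
  shows "\<exists>w. damped_solution DA A V S B w0 w1 w"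
  unfolding damped_solution_def C_def[symmetric]
  using wave_solution_exists[OF sqrt_A surj m S_bound damping] assms by simp

lemma undamped_trajectory:
  assumes "undamped_solution DA A V S w0 w1 \<phi>"
  shows "trajectory (\<lambda>x. 0) (\<lambda>t. S (\<phi> t)) (tderiv \<phi>)" "\<phi> 0 = w0" "tderiv \<phi> 0 = w1"
  using assms wave_solution_trajectory[OF sqrt_A]
  by (auto simp: undamped_solution_def wave_solution_def)

lemma damped_trajectory:
  assumes "damped_solution DA A V S B w0 w1 w"
  shows "trajectory (\<lambda>x. B (C x)) (\<lambda>t. S (w t)) (tderiv w)" "w 0 = w0" "tderiv w 0 = w1"
  using assms wave_solution_trajectory[OF sqrt_A]
  by (auto simp: damped_solution_def wave_solution_def C_def)

text \<open>The shift sits in the integrand, so that the time window starts at 0 and can be compared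
  with an undamped solution started from the state at time \<open>s\<close>.\<close>

lemma damped_energy_identity:
  assumes w: "damped_solution DA A V S B w0 w1 w" and "s \<ge> 0" "T \<ge> 0"
  shows "integral {0..T} (\<lambda>t. (norm (C (tderiv w (t + s))))\<^sup>2) = energy S w s - energy S w (s + T)"
proof -
  have "((\<lambda>t. (1/2) * (2 * (norm (C (tderiv w (t + s))))\<^sup>2)) has_integral
     (1/2) * (((norm (S (w (0 + s))))\<^sup>2 + (norm (tderiv w (0 + s)))\<^sup>2)
        - ((norm (S (w (T + s))))\<^sup>2 + (norm (tderiv w (T + s)))\<^sup>2))) {0..T}"
    using trajectory_energy_identity[OF trajectory_shift[OF damped_trajectory(1)[OF w] \<open>s \<ge> 0\<close>] C(2) \<open>T \<ge> 0\<close>]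
    by (rule has_integral_mult_right)
  then show ?thesis by (simp add: integral_unique energy_def field_simps)
qed

lemma energy_decreasing:
  assumes "damped_solution DA A V S B w0 w1 w" "0 \<le> s" "s \<le> t"
  shows "energy S w t \<le> energy S w s"
proof -
  have "0 \<le> integral {0..t - s} (\<lambda>r. (norm (C (tderiv w (r + s))))\<^sup>2)"
    using trajectory_shift[OF damped_trajectory(1)[OF assms(1)] assms(2)]
    by (intro Henstock_Kurzweil_Integration.integral_nonneg integrable_continuous_real continuous_intros
        trajectory_continuous_comp C(1)) auto
  then show ?thesis using damped_energy_identity[OF assms(1,2), of "t - s"] assms(3) by simp
qed

text \<open>At \<open>T = 1 / G y\<close> the decay bound is \<open>c * ?Q * y = ?N / 4\<close>,
  half of the initial energy \<open>?N / 2\<close>; this fixes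
  \<open>y = 1 / (4 * c * Lambda)\<close>. At least \<open>?N / 4\<close> is thus dissipated, which
  explains the factor 4.\<close>

theorem observability_of_decay:
  assumes G: "increasing_bijection G" and c: "c > 0"
    and data: "w0 \<in> DA" "w1 \<in> V" "(w0, w1) \<noteq> (0, 0)"
    and decay: "\<And>w t. damped_solution DA A V S B w0 w1 w \<Longrightarrow> t > 0 \<Longrightarrow>
      energy S w t \<le> c * sqnorm_DV A S w0 w1 * inv_into {0..} G (1 / t)"
    and \<phi>: "undamped_solution DA A V S w0 w1 \<phi>"
  shows "sqnorm_VX S w0 w1
    \<le> 4 * integral {0 .. 1 / G (1 / (2 * (2 * c) * Lambda A S w0 w1))} (\<lambda>t. (norm (C (tderiv \<phi> t)))\<^sup>2)"
proof -
  interpret G: increasing_bijection G by fact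
  let ?N = "sqnorm_VX S w0 w1" and ?Q = "sqnorm_DV A S w0 w1"
  have N: "?N > 0" using sqnorm_VX_pos data by blast
  have Q: "?Q > 0" using sqnorm_DV_ge[OF data(1,2)] m N by (smt (verit) mult_pos_pos)
  define y where "y = 1 / (2 * (2 * c) * Lambda A S w0 w1)"
  have y: "y = ?N / (4 * c * ?Q)" "y > 0" using N Q c by (auto simp: y_def Lambda_def)
  define T where "T = 1 / G y"
  have T: "T > 0" using G.pos[OF y(2)] by (simp add: T_def)
  obtain w where w: "damped_solution DA A V S B w0 w1 w" using damped_exists[OF data(1,2)] by blast
  have "energy S w T \<le> c * ?Q * inv_into {0..} G (G y)"
    using decay[OF w T] by (simp add: T_def)
  also have "\<dots> = ?N / 4" using G.inv[of y] y c Q by simp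
  finally have ET: "energy S w T \<le> ?N / 4" .
  have "energy S w 0 - energy S w T = integral {0..T} (\<lambda>t. (norm (C (tderiv w t)))\<^sup>2)"
    using damped_energy_identity[OF w, of 0 T] T by simp
  also have "\<dots> \<le> integral {0..T} (\<lambda>t. (norm (C (tderiv \<phi> t)))\<^sup>2)"
    using damped_trajectory[OF w] undamped_trajectory[OF \<phi>] T
    by (intro damped_observation_le[OF damped_trajectory(1)[OF w] undamped_trajectory(1)[OF \<phi>] _ _ C]) auto
  moreover have "energy S w 0 = ?N / 2"
    using damped_trajectory[OF w] by (simp add: energy_def sqnorm_VX_def)
  ultimately show ?thesis using ET by (simp add: T_def y_def)
qed

text \<open>Squared because the comparison of the \<open>D(A) \<times> V\<close> norm with the norm
  of the generator at the state is used twice, at time \<open>t\<close> and at time 0.\<close>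

definition graph_constant :: real where
  "graph_constant = (2 + 2 * (onorm (\<lambda>x. B (C x)))\<^sup>2 / m)\<^sup>2"

lemma graph_constant_pos: "graph_constant > 0"
proof -
  have "2 + 2 * (onorm (\<lambda>x. B (C x)))\<^sup>2 / m > 0" using m by (simp add: add_pos_nonneg)
  then show ?thesis by (simp add: graph_constant_def)
qed

lemma damped_sqnorm_DV_bound:
  assumes w: "damped_solution DA A V S B w0 w1 w" and t: "t \<ge> 0"
  shows "sqnorm_DV A S (w t) (tderiv w t) \<le> graph_constant * sqnorm_DV A S w0 w1"
proof -
  define K where "K x = B (C x)" for x
  define a where "a = 2 + 2 * (onorm K)\<^sup>2 / m"
  have K: "bounded_linear K" "\<And>x. inner (K x) x \<ge> 0" using damping by (auto simp: K_def[abs_def])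
  have a: "a \<ge> 0" using m by (simp add: a_def)
  \<comment> \<open>Symmetric in \<open>y\<close> and \<open>z\<close>, so that it serves both
    directions: the two vectors will be \<open>S p\<close> and \<open>S p + K v\<close>, and
    \<open>S_bound\<close> controls \<open>K v\<close> by \<open>S v\<close>.\<close>
  have eq: "x \<in> V \<Longrightarrow> y = z + K x \<or> z = y + K x \<Longrightarrow>
      (norm z)\<^sup>2 + (norm (S x))\<^sup>2 \<le> a * ((norm y)\<^sup>2 + (norm (S x))\<^sup>2)" for x y z
  proof -
    assume x: "x \<in> V" and yz: "y = z + K x \<or> z = y + K x"
    have "norm z \<le> norm y + norm (K x)"
      using yz norm_triangle_ineq4[of y "K x"] norm_triangle_ineq[of y "K x"] by auto
    then have "(norm z)\<^sup>2 \<le> (norm y + norm (K x))\<^sup>2" by (simp add: power_mono)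
    also have "\<dots> \<le> 2 * (norm y)\<^sup>2 + 2 * (norm (K x))\<^sup>2"
      using sum_squares_bound[of "norm y" "norm (K x)"] by (simp add: power2_sum)
    also have "(norm (K x))\<^sup>2 \<le> (onorm K)\<^sup>2 * ((norm (S x))\<^sup>2 / m)"
    proof -
      have "(norm (K x))\<^sup>2 \<le> (onorm K * norm x)\<^sup>2" using onorm[OF K(1)] by (simp add: power_mono)
      also have "\<dots> = (onorm K)\<^sup>2 * (norm x)\<^sup>2" by (simp add: power_mult_distrib)
      also have "\<dots> \<le> (onorm K)\<^sup>2 * ((norm (S x))\<^sup>2 / m)"
        using S_bound[OF x] m by (intro mult_left_mono) (simp_all add: field_simps)
      finally show ?thesis .
    qed
    finally have "(norm z)\<^sup>2 \<le> 2 * (norm y)\<^sup>2 + 2 * (onorm K)\<^sup>2 / m * (norm (S x))\<^sup>2" by simp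
    moreover have "0 \<le> 2 * (onorm K)\<^sup>2 / m * (norm y)\<^sup>2" using m by simp
    moreover have "0 \<le> (norm (S x))\<^sup>2" by simp
    ultimately show ?thesis unfolding a_def distrib_left distrib_right by linarith
  qed
  have tr: "trajectory K (\<lambda>t. S (w t)) (tderiv w)"
    using damped_trajectory(1)[OF w] by (simp add: K_def[abs_def])
  have DV: "sqnorm_DV A S (w t) (tderiv w t) = (norm (S (S (w t))))\<^sup>2 + (norm (S (tderiv w t)))\<^sup>2"
    if "t \<ge> 0" for t
    using w that in_DA(2)[of "w t"] by (simp add: sqnorm_DV_def damped_solution_def wave_solution_def)
  have g: "(norm (gen K (S (w t), tderiv w t)))\<^sup>2
      = (norm (S (S (w t)) + K (tderiv w t)))\<^sup>2 + (norm (S (tderiv w t)))\<^sup>2" for t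
  proof -
    have "norm (- S (S (w t)) - K (tderiv w t)) = norm (S (S (w t)) + K (tderiv w t))"
      by (metis minus_add_distrib norm_minus_cancel diff_conv_add_uminus)
    then show ?thesis by (simp add: gen_def norm_Pair)
  qed
  have "sqnorm_DV A S (w t) (tderiv w t) \<le> a * (norm (gen K (S (w t), tderiv w t)))\<^sup>2"
    unfolding DV[OF t] g using trajectoryD(2)[OF tr t] by (intro eq) auto
  also have "\<dots> \<le> a * (norm (gen K (S (w 0), tderiv w 0)))\<^sup>2"
    using trajectory_gen_decreasing[OF K tr t] a by (intro mult_left_mono power_mono) auto
  also have "\<dots> \<le> a * (a * sqnorm_DV A S (w 0) (tderiv w 0))"
    unfolding DV[OF order_refl] g using trajectoryD(2)[OF tr order_refl] a by (intro mult_left_mono eq) auto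
  also have "\<dots> = graph_constant * sqnorm_DV A S w0 w1"
    using damped_trajectory[OF w]
    by (simp add: graph_constant_def a_def K_def[abs_def] power2_eq_square)
  finally show ?thesis .
qed

theorem decay_of_observability:
  assumes G: "increasing_bijection G" and F: "\<And>x. 0 \<le> x \<Longrightarrow> F x = x * (G x)\<^sup>2" and c: "c > 0"
    and obs: "\<And>w0 w1 \<phi>. w0 \<in> DA \<Longrightarrow> w1 \<in> V \<Longrightarrow> (w0, w1) \<noteq> (0, 0) \<Longrightarrow>
      undamped_solution DA A V S w0 w1 \<phi> \<Longrightarrow> sqnorm_VX S w0 w1
        \<le> c * integral {0 .. 1 / G (1 / (2 * c * Lambda A S w0 w1))} (\<lambda>t. (norm (C (tderiv \<phi> t)))\<^sup>2)"
  shows "\<exists>c'>0. \<forall>w0\<in>DA. \<forall>w1\<in>V. (w0, w1) \<noteq> (0, 0) \<longrightarrow>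
    (\<forall>w. damped_solution DA A V S B w0 w1 w \<longrightarrow>
      (\<forall>t>0. energy S w t \<le> c' * sqnorm_DV A S w0 w1 * inv_into {0..} F (1 / sqrt t)))"
proof -
  interpret G: increasing_bijection G by fact
  obtain \<beta> where \<beta>: "\<beta> > 0" "\<And>x. norm (C x) \<le> \<beta> * norm x"
    using bounded_linear.pos_bounded[OF C(1)] by (metis mult.commute)
  define c1 where "c1 = graph_constant"
  have c1: "c1 > 0" using graph_constant_pos by (simp add: c1_def)
  \<comment> \<open>An upper bound for \<open>e 0\<close>: the initial energy is at most
    \<open>?Q / (2 * m)\<close> and is divided by \<open>c * c1 * ?Q\<close>.\<close>
  define M where "M = 1 / (2 * m * c * c1)"
  have M: "M > 0" using m c c1 by (simp add: M_def)
  \<comment> \<open>Half the coefficient of \<open>T\<^sup>2\<close> that results once the summand 2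
    of the comparison constant is replaced by \<open>2 * (G M)\<^sup>2 * T\<^sup>2\<close>.\<close>
  define \<kappa> where "\<kappa> = c * ((G M)\<^sup>2 + 4 * \<beta> ^ 4)"
  have \<kappa>: "\<kappa> > 0" using c \<beta> by (simp add: \<kappa>_def add_nonneg_pos)
  \<comment> \<open>Kept at least 1 because \<open>le_weighted_inverse\<close> moves only such
    factors outside the inverse.\<close>
  define k where "k = max 1 (sqrt (M * G M * (\<kappa> * M)))"
  have k: "k \<ge> 1" by (simp add: k_def)
  have main: "energy S w t \<le> (c * c1 * k) * sqnorm_DV A S w0 w1 * inv_into {0..} F (1 / sqrt t)"
    if data: "w0 \<in> DA" "w1 \<in> V" "(w0, w1) \<noteq> (0, 0)" and w: "damped_solution DA A V S B w0 w1 w"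
      and t: "t > 0" for w0 w1 w t
  proof -
    let ?N = "sqnorm_VX S w0 w1" and ?Q = "sqnorm_DV A S w0 w1"
    let ?E = "energy S w"
    have N: "?N > 0" using sqnorm_VX_pos data by blast
    have Q: "?Q > 0" using sqnorm_DV_ge[OF data(1,2)] m N by (smt (verit) mult_pos_pos)
    \<comment> \<open>With this divisor, and since the \<open>D(A) \<times> V\<close> norm at time
      \<open>s\<close> is at most \<open>c1 * ?Q\<close>, \<open>e s\<close> is at most
      \<open>1 / (2 * c * Lambda)\<close> for the state at time \<open>s\<close>.\<close>
    define D where "D = c * c1 * ?Q"
    have D: "D > 0" using c c1 Q by (simp add: D_def)
    define e where "e s = ?E s / D" for s
    have Ee: "?E s = D * e s" for s using D by (simp add: e_def)
    have anti: "e s' \<le> e s" if "0 \<le> s" "s \<le> s'" for s s'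
      using energy_decreasing[OF w that] D by (simp add: e_def divide_right_mono)
    have e0: "0 \<le> e s" for s using D by (simp add: e_def energy_def)
    have "?E 0 = ?N / 2" using damped_trajectory[OF w] by (simp add: energy_def sqnorm_VX_def)
    also have "\<dots> \<le> ?Q / (2 * m)" using sqnorm_DV_ge[OF data(1,2)] m by (simp add: field_simps)
    also have "\<dots> = D * M" using c c1 m by (simp add: D_def M_def)
    finally have eM: "e 0 \<le> M" using D by (simp add: Ee)
    have step: "e s * (G (e s))\<^sup>2 \<le> \<kappa> * (e s - e (s + 1 / G (e s)))" if s: "0 \<le> s" "0 < e s" for s
    proof -
      define T where "T = 1 / G (e s)"
      have Ge: "G (e s) > 0" using G.pos[OF s(2)] .
      have T: "T > 0" using Ge by (simp add: T_def)
      have Es: "?E s > 0" using s D by (simp add: Ee)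
      let ?u = "w s" and ?v = "tderiv w s"
      have uv: "?u \<in> DA" "?v \<in> V" using w s(1) by (auto simp: damped_solution_def wave_solution_def)
      have Ns: "sqnorm_VX S ?u ?v = 2 * ?E s" by (simp add: energy_def sqnorm_VX_def)
      have "(?u, ?v) \<noteq> (0, 0)" using Es by (auto simp: energy_def zero)
      obtain \<phi> where \<phi>: "undamped_solution DA A V S ?u ?v \<phi>" using undamped_exists[OF uv] by blast
      define T' where "T' = 1 / G (1 / (2 * c * Lambda A S ?u ?v))"
      have Qs: "sqnorm_DV A S ?u ?v > 0" "sqnorm_DV A S ?u ?v \<le> c1 * ?Q"
        using sqnorm_DV_ge[OF uv] m Es mult_pos_pos[of m "2 * ?E s"] damped_sqnorm_DV_bound[OF w s(1)]
        unfolding Ns c1_def by linarith+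
      have "e s \<le> ?E s / (c * sqnorm_DV A S ?u ?v)"
        unfolding e_def D_def using Qs Es c c1 Q by (intro divide_left_mono) (auto simp: mult.assoc)
      also have "\<dots> = 1 / (2 * c * Lambda A S ?u ?v)" using c Qs Es by (simp add: Lambda_def Ns)
      finally have "G (e s) \<le> G (1 / (2 * c * Lambda A S ?u ?v))" using s(2) by (intro G.le) auto
      then have T': "T' \<le> T" using Ge by (simp add: T_def T'_def frac_le)
      have int: "(\<lambda>t. (norm (C (tderiv \<phi> t)))\<^sup>2) integrable_on {0..T}" for T
        by (intro integrable_continuous_real continuous_intros
            trajectory_continuous_comp[OF undamped_trajectory(1)[OF \<phi>] C(1)])
      have "2 * ?E s \<le> c * integral {0..T'} (\<lambda>t. (norm (C (tderiv \<phi> t)))\<^sup>2)"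
        using obs[OF uv \<open>(?u, ?v) \<noteq> (0, 0)\<close> \<phi>] by (simp add: Ns T'_def)
      also have "\<dots> \<le> c * integral {0..T} (\<lambda>t. (norm (C (tderiv \<phi> t)))\<^sup>2)"
        using c T' int by (intro mult_left_mono integral_subset_le) auto
      also have "\<dots> \<le> c * ((2 + 8 * \<beta> ^ 4 * T\<^sup>2) * integral {0..T} (\<lambda>t. (norm (C (tderiv w (t + s))))\<^sup>2))"
        using undamped_trajectory[OF \<phi>] c
        by (intro mult_left_mono undamped_observation_le[OF
              trajectory_shift[OF damped_trajectory(1)[OF w] s(1)] undamped_trajectory(1)[OF \<phi>]
              _ _ C(1) C(2) T \<beta>]) auto
      also have "\<dots> = c * (2 + 8 * \<beta> ^ 4 * T\<^sup>2) * (?E s - ?E (s + T))"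
        using damped_energy_identity[OF w s(1), of T] T by simp
      \<comment> \<open>As \<open>e s \<le> M\<close>, the time \<open>T\<close> is at least
        \<open>1 / G M\<close>, so the constant 2 can be traded for a multiple of
        \<open>T\<^sup>2\<close>.\<close>
      also have "\<dots> \<le> c * (2 * (G M)\<^sup>2 * T\<^sup>2 + 8 * \<beta> ^ 4 * T\<^sup>2) * (?E s - ?E (s + T))"
      proof -
        have "e s \<le> M" using anti[of 0 s] s eM by simp
        then have "1 \<le> G M * T" using G.le[of "e s" M] s Ge by (simp add: T_def field_simps)
        then have "1 \<le> (G M * T)\<^sup>2" by (simp add: one_le_power)
        then have "2 \<le> 2 * (G M)\<^sup>2 * T\<^sup>2" by (simp add: power_mult_distrib)
        moreover have "0 \<le> ?E s - ?E (s + T)" using energy_decreasing[OF w, of s "s + T"] s T by simp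
        ultimately show ?thesis using c by (intro mult_right_mono mult_left_mono) auto
      qed
      also have "\<dots> = 2 * (\<kappa> * T\<^sup>2 * (?E s - ?E (s + T)))" by (simp add: \<kappa>_def algebra_simps)
      finally have "D * e s \<le> D * (\<kappa> * T\<^sup>2 * (e s - e (s + T)))" by (simp add: Ee algebra_simps)
      then have "e s \<le> \<kappa> * T\<^sup>2 * (e s - e (s + T))" using D by simp
      then have "e s * (G (e s))\<^sup>2 \<le> \<kappa> * T\<^sup>2 * (e s - e (s + T)) * (G (e s))\<^sup>2"
        by (simp add: mult_right_mono)
      also have "\<dots> = \<kappa> * (e s - e (s + T)) * (T * G (e s))\<^sup>2" by (simp add: power_mult_distrib)
      also have "T * G (e s) = 1" using Ge by (simp add: T_def)
      finally show ?thesis by (simp add: T_def)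
    qed
    have "e t * (G (e t))\<^sup>2 \<le> sqrt (M * G M * (\<kappa> * M)) * (1 / sqrt t)"
      by (rule G.decay_of_step_inequality[OF anti e0 eM \<kappa> step t])
    also have "\<dots> \<le> k * (1 / sqrt t)" using t by (intro mult_right_mono) (auto simp: k_def)
    finally have "e t \<le> k * inv_into {0..} F (1 / sqrt t)"
      using t k e0 by (intro G.le_weighted_inverse[OF F]) auto
    then have "D * e t \<le> D * (k * inv_into {0..} F (1 / sqrt t))" using D by simp
    then show ?thesis by (simp add: Ee D_def algebra_simps)
  qed
  have "c * c1 * k > 0" using c c1 k by simp
  with main show ?thesis by blast
qed

end

theorem theorem1p1:
  fixes A S :: "'x::complex_hilbert \<Rightarrow> 'x" and DA V :: "'x set"
    and B :: "'u::complex_hilbert \<Rightarrow> 'x"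
    and G F :: "real \<Rightarrow> real"
  assumes A: "linear_operator DA A" "unbounded_operator DA A"
      "self_adjoint_operator DA A" "strictly_positive_operator DA A"
    and sqrt_A: "operator_sqrt DA A V S"
    and B: "bounded_clinear B"
    and G: "continuous_on {0..} G" "strict_mono_on {0..} G" "bij_betw G {0..} {0..}"
    and F: "\<And>x. 0 \<le> x \<Longrightarrow> F x = x * (G x)\<^sup>2"
  shows
   "((\<exists>C>0. \<forall>w0\<in>DA. \<forall>w1\<in>V. (w0, w1) \<noteq> (0, 0) \<longrightarrow>
        (\<forall>w. damped_solution DA A V S B w0 w1 w \<longrightarrow>
          (\<forall>t>0. energy S w t \<le> C * sqnorm_DV A S w0 w1 * inv_into {0..} G (1 / t))))
     \<longrightarrow>
     (\<exists>C>0. \<forall>w0\<in>DA. \<forall>w1\<in>V. (w0, w1) \<noteq> (0, 0) \<longrightarrow>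
        (\<forall>\<phi>. undamped_solution DA A V S w0 w1 \<phi> \<longrightarrow>
          sqnorm_VX S w0 w1 \<le>
            16 * integral {0 .. 1 / G (1 / (2 * C * Lambda A S w0 w1))}
                   (\<lambda>t. (norm (cadjoint B (tderiv \<phi> t)))\<^sup>2))))
    \<and>
    (mono_on {0<..} (\<lambda>x. x * inv_into {0..} F (1 / x)) \<and>
     (\<exists>C>0. \<forall>w0\<in>DA. \<forall>w1\<in>V. (w0, w1) \<noteq> (0, 0) \<longrightarrow>
        (\<forall>\<phi>. undamped_solution DA A V S w0 w1 \<phi> \<longrightarrow>
          sqnorm_VX S w0 w1 \<le>
            C * integral {0 .. 1 / G (1 / (2 * C * Lambda A S w0 w1))}
                   (\<lambda>t. (norm (cadjoint B (tderiv \<phi> t)))\<^sup>2)))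
     \<longrightarrow>
     (\<exists>C>0. \<forall>w0\<in>DA. \<forall>w1\<in>V. (w0, w1) \<noteq> (0, 0) \<longrightarrow>
        (\<forall>w. damped_solution DA A V S B w0 w1 w \<longrightarrow>
          (\<forall>t>0. energy S w t \<le>
             C * sqnorm_DV A S w0 w1 * inv_into {0..} F (1 / sqrt t)))))"
proof -
  obtain m where m: "m > 0" "\<And>x. x \<in> DA \<Longrightarrow> m * (norm x)\<^sup>2 \<le> Re (cinner (A x) x)"
    using A(4) unfolding strictly_positive_operator_def by blast
  interpret W: damped_wave V S DA A B m
  proof unfold_locales
    show "self_adjoint_operator V S" using sqrt_A by (simp add: operator_sqrt_def)
    show "S ` V = UNIV" by (rule strictly_positive_sqrt_bound(1)[OF A(3) sqrt_A m])
    show "x \<in> V \<Longrightarrow> m * (norm x)\<^sup>2 \<le> (norm (S x))\<^sup>2" for x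
      by (rule strictly_positive_sqrt_bound(2)[OF A(3) sqrt_A m])
  qed (fact sqrt_A B m(1))+
  have G': "increasing_bijection G" using G by unfold_locales
  show ?thesis
  proof (intro conjI impI, goal_cases)
    case 1
    then show ?case
    proof (elim exE conjE, goal_cases)
      case (1 c)
      note c = 1(1) and decay = 1(2)[rule_format]
      show ?case
      proof (intro exI[of _ "2 * c"] conjI ballI impI allI)
        fix w0 w1 \<phi>
        assume data: "w0 \<in> DA" "w1 \<in> V" "(w0, w1) \<noteq> (0, 0)" and \<phi>: "undamped_solution DA A V S w0 w1 \<phi>"
        let ?I = "integral {0 .. 1 / G (1 / (2 * (2 * c) * Lambda A S w0 w1))}
          (\<lambda>t. (norm (cadjoint B (tderiv \<phi> t)))\<^sup>2)"
        have "sqnorm_VX S w0 w1 \<le> 4 * ?I"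
          using W.observability_of_decay[OF G' c data decay[OF data] \<phi>] by (simp add: W.C_def)
        \<comment> \<open>Positivity of the left side forces \<open>?I\<close> to be positive, which
          allows enlarging 4 to 16.\<close>
        moreover have "0 < sqnorm_VX S w0 w1" by (rule W.sqnorm_VX_pos[OF data])
        ultimately show "sqnorm_VX S w0 w1 \<le> 16 * ?I" by linarith
      qed (use c in simp)
    qed
  next
    case 2
    then show ?case
    proof (elim exE conjE, goal_cases)
      case (1 c)
      note c = 1(2) and obs = 1(3)[rule_format]
      show ?case
        by (rule W.decay_of_observability[OF G' F c, unfolded W.C_def, OF _ obs])
    qed
  qed
qed

end
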